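(* Let $M\ge 1$ and let $(V^{(1)},\ldots,V^{(M)})$ be a vector of real-valued random variables with $\mathbb{P}(V^{(i)}>0)>0$ and $\mathbb{E}[V^{(i)}]<0$ for $i=1,\ldots,M$; let $(V^{(1)}_1,\ldots,V^{(M)}_1),(V^{(1)}_2,\ldots,V^{(M)}_2),\ldots$ be i.i.d. copies of it. Denote $$\mathcal{V}_M(v_1,\ldots,v_M):=\left(\bigwedge_{1\le i\le 2}(v_i-V^{(i)}),\ \ldots,\ \bigwedge_{M-1\le i\le M}(v_i-V^{(i)}),\ v_M-V^{(M)}\right),$$ i.e. the $j$-th component is $\min\{v_j-V^{(j)},v_{j+1}-V^{(j+1)}\}$ for $1\le j\le M-1$ and the $M$-th is $v_M-V^{(M)}$. For $j=1,\ldots,M$ and $k\in\mathbb{N}$ put $$T^j_k:=\sup_{k\le i_j<i_{j-1}<\cdots<i_1<\infty}\left(V^{(j)}_k+\cdots+V^{(j)}_{i_j}+V^{(j-1)}_{i_j+1}+\cdots+V^{(j-1)}_{i_{j-1}}+\cdots+V^{(1)}_{i_2+1}+\cdots+V^{(1)}_{i_1}\right).$$ (a) The integral equation (for all $(v_1,\ldots,v_M)\in\overline{\mathbb{R}}^M$) $$\mathbb{E}\left[\mathbf{1}_{\{v_1\ge V^{(1)}\}}\,\psi_M\left(\mathcal{V}_M(v_1,\ldots,v_M)\right)\right]=\psi_M(v_1,\ldots,v_M)$$ admits a unique solution in the class of bounded functions on $\overline{\mathbb{R}}^M$ having the limit $\psi_M(\infty,\ldots,\infty)=\lim_{v_1,\ldots,v_M\to\infty}\psi_M(v_1,\ldots,v_M)=1$.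 It is given by $\psi_M(v_1,\ldots,v_M):=\mathbb{P}\left(T^1_1\le v_1,\ldots,T^M_1\le v_M\right)$. (b) Let $\gamma_M:\overline{\mathbb{R}}^M\to(-\infty,K_{\gamma_M}]$, for some finite $K_{\gamma_M}$, satisfy for all $(v_1,\ldots,v_M)\in\operatorname{supp}(\gamma_M\vee0)$ $$\mathbb{E}\left[\mathbf{1}_{\{v_1\ge V^{(1)}\}}\,\gamma_M\left(\mathcal{V}_M(v_1,\ldots,v_M)\right)\right]\ge\gamma_M(v_1,\ldots,v_M).$$ If $\gamma_M(\infty,\ldots,\infty)=\limsup_{v_1,\ldots,v_M\to\infty}\gamma_M(v_1,\ldots,v_M)=1$, then $\psi_M\ge\gamma_M$. (c) Let $\eta_M:\overline{\mathbb{R}}^M\to[0,\infty)$ satisfy for all $(v_1,\ldots,v_M)\in\operatorname{supp}(\psi_M)$ $$\mathbb{E}\left[\mathbf{1}_{\{v_1\ge V^{(1)}\}}\,\eta_M\left(\mathcal{V}_M(v_1,\ldots,v_M)\right)\right]\le\eta_M(v_1,\ldots,v_M).$$ If $\eta_M(\infty,\ldots,\infty)=\liminf_{v_1,\ldots,v_M\to\infty}\eta_M(v_1,\ldots,v_M)=1$, then $\psi_M\le\eta_M$. In (b) and (c), $\psi_M$ is the function from (a).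
   Context: Notation: $\overline{\mathbb{R}}:=\mathbb{R}\cup\{\pm\infty\}$ with its usual topology and $\pm\infty-x=\pm\infty$ for real $x$; $\bigwedge$ denotes minimum; $\operatorname{supp}(\phi):=\{x:\phi(x)\ne0\}$ and $\operatorname{supp}(\phi\vee0):=\{x:\phi(x)>0\}$ (no closure). All functions are Borel measurable. Limits as $v_1,\ldots,v_M\to\infty$ are taken over points of $\overline{\mathbb{R}}^M$ tending to $(\infty,\ldots,\infty)$. Expectations $\mathbb{E}[V^{(i)}]$ may equal $-\infty$ (positive parts integrable). In the application $V^{(i)}=Y^{(i)}-X$ where $X$ is the inter-arrival time and $Y^{(i)}$ the service time at queue $i$ of a tandem of $M$ queues. *)

theory Defs
  imports "HOL-Probability.Probability"
begin

text \<open>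
  Vectors with components \<open>1, \<dots>, M\<close> are the elements of the library product measure spaces over
  the index set \<open>{1..M}\<close>, that is, functions on \<open>nat\<close> with value \<open>undefined\<close> outside \<open>{1..M}\<close>.
\<close>

abbreviation real_vec :: "nat \<Rightarrow> (nat \<Rightarrow> real) measure" where
  "real_vec M \<equiv> PiM {1..M} (\<lambda>_. borel)"

abbreviation ereal_vec :: "nat \<Rightarrow> (nat \<Rightarrow> ereal) measure" where
  "ereal_vec M \<equiv> PiM {1..M} (\<lambda>_. borel)"

abbreviation rbar :: "nat \<Rightarrow> (nat \<Rightarrow> ereal) set" where
  "rbar M \<equiv> {1..M} \<rightarrow>\<^sub>E UNIV"

definition infty_vec :: "nat \<Rightarrow> nat \<Rightarrow> ereal" where
  "infty_vec M = (\<lambda>i\<in>{1..M}. \<infinity>)"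

text \<open>
  The type \<open>nat \<Rightarrow> ereal\<close> carries the product topology. All elements of \<open>rbar M\<close> agree outside
  \<open>{1..M}\<close>, so the subspace topology on \<open>rbar M\<close> is the usual one, and the following is the filter
  of all components tending to infinity at once.
\<close>

abbreviation to_infty :: "nat \<Rightarrow> (nat \<Rightarrow> ereal) filter" where
  "to_infty M \<equiv> at (infty_vec M) within rbar M"

definition supp :: "nat \<Rightarrow> ((nat \<Rightarrow> ereal) \<Rightarrow> real) \<Rightarrow> (nat \<Rightarrow> ereal) set" where
  "supp M f = {v \<in> rbar M. f v \<noteq> 0}"

text \<open>
  Expectation with values in the extended reals, meaningful if the positive or the negative part
  is integrable. The Bochner integral is not suitable here, being 0 for non-integrable functions.
\<close>

definition ext_expectation :: "'a measure \<Rightarrow> ('a \<Rightarrow> real) \<Rightarrow> ereal" where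
  "ext_expectation P X =
     enn2ereal (\<integral>\<^sup>+\<omega>. ennreal (X \<omega>) \<partial>P) - enn2ereal (\<integral>\<^sup>+\<omega>. ennreal (- X \<omega>) \<partial>P)"

text \<open>\<open>step M v x\<close> is the value of the vector \<open>\<V>\<^sub>M(v)\<close> when the random vector takes the value \<open>x\<close>.\<close>

definition step :: "nat \<Rightarrow> (nat \<Rightarrow> ereal) \<Rightarrow> (nat \<Rightarrow> real) \<Rightarrow> nat \<Rightarrow> ereal" where
  "step M v x = (\<lambda>j\<in>{1..M}.
     if j < M then min (v j - ereal (x j)) (v (j + 1) - ereal (x (j + 1)))
     else v M - ereal (x M))"

definition integrand ::
  "nat \<Rightarrow> ('a \<Rightarrow> nat \<Rightarrow> real) \<Rightarrow> ((nat \<Rightarrow> ereal) \<Rightarrow> real) \<Rightarrow> (nat \<Rightarrow> ereal) \<Rightarrow> 'a \<Rightarrow> real" where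
  "integrand M V f v \<omega> = indicator {\<omega>. v 1 \<ge> ereal (V \<omega> 1)} \<omega> * f (step M v (V \<omega>))"

text \<open>
  \<open>W n \<omega> l\<close> is the \<open>l\<close>-th component of the \<open>n\<close>-th random vector. The index tuple
  \<open>k \<le> i j < i (j - 1) < \<dots> < i 1\<close> is a function on \<open>{1..j}\<close>.
\<close>

definition paths :: "nat \<Rightarrow> nat \<Rightarrow> (nat \<Rightarrow> nat) set" where
  "paths j k = {i \<in> {1..j} \<rightarrow>\<^sub>E UNIV. k \<le> i j \<and> (\<forall>l\<in>{1..<j}. i (l + 1) < i l)}"

definition T :: "(nat \<Rightarrow> 'a \<Rightarrow> nat \<Rightarrow> real) \<Rightarrow> nat \<Rightarrow> nat \<Rightarrow> 'a \<Rightarrow> ereal" where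
  "T W j k \<omega> = (SUP i\<in>paths j k.
     ereal ((\<Sum>n=k..i j. W n \<omega> j) + (\<Sum>l\<in>{1..<j}. \<Sum>n=i (l + 1) + 1..i l. W n \<omega> l)))"

definition psi ::
  "'a measure \<Rightarrow> nat \<Rightarrow> (nat \<Rightarrow> 'a \<Rightarrow> nat \<Rightarrow> real) \<Rightarrow> (nat \<Rightarrow> ereal) \<Rightarrow> real" where
  "psi P M W v = measure P {\<omega> \<in> space P. \<forall>j\<in>{1..M}. T W j 1 \<omega> \<le> v j}"

definition solution ::
  "'a measure \<Rightarrow> nat \<Rightarrow> ('a \<Rightarrow> nat \<Rightarrow> real) \<Rightarrow> ((nat \<Rightarrow> ereal) \<Rightarrow> real) \<Rightarrow> bool" where
  "solution P M V f \<longleftrightarrow>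
     f \<in> borel_measurable (ereal_vec M) \<and>
     (\<exists>B. \<forall>v\<in>rbar M. \<bar>f v\<bar> \<le> B) \<and>
     f (infty_vec M) = 1 \<and> (f \<longlongrightarrow> 1) (to_infty M) \<and>
     (\<forall>v\<in>rbar M. (\<integral>\<omega>. integrand M V f v \<omega> \<partial>P) = f v)"

end

theory Submission
  imports Defs
begin

text \<open>
  Two facts carry the proof.

  The first is a comparison principle. Let \<open>\<psi>\<close> be a nonnegative solution and \<open>\<gamma>\<close> a subsolution as
  in part (b), and put \<open>u = max 0 (\<gamma> - \<psi>)\<close>. Then \<open>u\<close> is bounded, lies below its own average over
  one step, in which the value counts as 0 if the first component is smaller than its increment,
  and vanishes at infinity. Let \<open>c\<close> be its supremum. From a point with some component below a
  level \<open>R\<close>, finitely many steps with positive increments lead, with a probability bounded below,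
  to a first component that is smaller than its increment, where the integrand is 0. Hence
  \<open>u \<le> (1 - q) c\<close> at all these points for some \<open>q > 0\<close>, while \<open>u \<le> c / 2\<close> at the remaining ones if
  \<open>R\<close> is large; so \<open>c = 0\<close> (\<open>vanishing_subsolution_le_0\<close>), that is, \<open>\<gamma> \<le> \<psi>\<close>
  (\<open>subsolution_le_nonneg_solution\<close>). Negative drift enters through the limit of \<open>\<psi>\<close> at infinity.

  This principle also yields uniqueness and part (c). For every solution \<open>f\<close> the function
  \<open>2 \<psi> - f\<close> is a solution too, and comparison gives \<open>f \<le> \<psi>\<close> and \<open>2 \<psi> - f \<le> \<psi>\<close>. If \<open>\<eta>\<close> is as in
  part (c), then \<open>2 \<psi> - \<eta>\<close> can be positive only where \<open>\<psi>\<close> is, so it satisfies the hypotheses of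
  part (b), and \<open>2 \<psi> - \<eta> \<le> \<psi>\<close>.

  The second fact is that \<open>\<psi>\<close> is a solution. Its equation is the decomposition of a path according
  to its first step: the event \<open>T\<^sup>j\<^sub>1 \<le> v\<^sub>j\<close> for all \<open>j\<close> says that the first increment of
  component 1 is at most \<open>v\<^sub>1\<close> and that the suprema that start at time 2 stay below the vector
  \<open>step M v\<close> (\<open>all_T_le_iff_step\<close>). The limit 1 at infinity says that all \<open>T\<^sup>j\<^sub>1\<close> are finite
  almost surely (\<open>T_coord_less_top\<close>). After truncation and upward shifts of the increments, the
  means may be assumed to be \<open>-m/M, -2m/M, \<dots>, -m\<close>. Summation by parts turns a path sum into a sum
  of values of \<open>M\<close> random walks, with increments \<open>V\<^sup>l - V\<^sup>l\<^sup>-\<^sup>1\<close> (where \<open>V\<^sup>0 = 0\<close>) of mean \<open>-m/M\<close>,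
  taken at the switching times (\<open>path_sum_eq_sum_difference_walks\<close>). Each of them is bounded above
  (\<open>random_walk_bounded_above\<close>), however strongly the components depend on each other.
\<close>

section \<open>Random walks with negative drift\<close>

lemma (in pair_prob_space) integrable_compose_fst:
  fixes f :: "'a \<Rightarrow> real"
  assumes "integrable M1 f"
  shows "integrable (M1 \<Otimes>\<^sub>M M2) (\<lambda>x. f (fst x))"
proof (rule Fubini_integrable)
  show "(\<lambda>x. f (fst x)) \<in> borel_measurable (M1 \<Otimes>\<^sub>M M2)" using assms by measurable
qed (use assms in \<open>simp_all add: M2.prob_space\<close>)

lemma (in pair_prob_space) integrable_compose_snd:
  fixes f :: "'b \<Rightarrow> real"
  assumes "integrable M2 f"
  shows "integrable (M1 \<Otimes>\<^sub>M M2) (\<lambda>x. f (snd x))"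
proof (rule Fubini_integrable)
  show "(\<lambda>x. f (snd x)) \<in> borel_measurable (M1 \<Otimes>\<^sub>M M2)" using assms by measurable
qed (use assms in \<open>simp_all add: M1.prob_space\<close>)

text \<open>
  The maximum of the first \<open>n + 1\<close> partial sums of \<open>f (\<omega> 0), f (\<omega> 1), \<dots>\<close>, in the recursive form that
  expresses it through the shifted sequence.
\<close>

primrec walk_max :: "('a \<Rightarrow> real) \<Rightarrow> nat \<Rightarrow> (nat \<Rightarrow> 'a) \<Rightarrow> real" where
  "walk_max f 0 \<omega> = f (\<omega> 0)"
| "walk_max f (Suc n) \<omega> = f (\<omega> 0) + max 0 (walk_max f n (\<lambda>k. \<omega> (Suc k)))"

lemma partial_sum_le_walk_max: "k \<le> n \<Longrightarrow> (\<Sum>i\<le>k. f (\<omega> i)) \<le> walk_max f n \<omega>"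
proof (induction n arbitrary: k \<omega>)
  case (Suc n)
  show ?case
  proof (cases k)
    case (Suc k')
    then have "(\<Sum>i\<le>k'. f (\<omega> (Suc i))) \<le> walk_max f n (\<lambda>k. \<omega> (Suc k))"
      using Suc.IH[of k' "\<lambda>k. \<omega> (Suc k)"] Suc.prems by simp
    then show ?thesis unfolding Suc by (simp add: sum.atMost_Suc_shift del: sum.atMost_Suc)
  qed simp
qed simp

lemma walk_max_Suc_ge: "walk_max f n \<omega> \<le> walk_max f (Suc n) \<omega>"
proof (induction n arbitrary: \<omega>)
  case (Suc n)
  show ?case using Suc[of "\<lambda>k. \<omega> (Suc k)"] by simp
qed simp

lemma walk_max_mono: "m \<le> n \<Longrightarrow> walk_max f m \<omega> \<le> walk_max f n \<omega>"
  by (rule lift_Suc_mono_le[of "\<lambda>n. walk_max f n \<omega>"]) (rule walk_max_Suc_ge)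

context sequence_space
begin

sublocale M_S: pair_prob_space M S ..

lemma measurable_iter:
  "(\<lambda>(s, \<omega>). case_nat s \<omega>) \<in> M \<Otimes>\<^sub>M S \<rightarrow>\<^sub>M S"
  by measurable

text \<open>
  An i.i.d. sequence has the law of a first entry followed by an independent copy of the
  sequence; the next three lemmas are this identity for nonnegative integrals, integrability and
  Bochner integrals.
\<close>
lemma nn_integral_iter:
  assumes "f \<in> borel_measurable S"
  shows "(\<integral>\<^sup>+\<omega>. f \<omega> \<partial>S) = (\<integral>\<^sup>+s. \<integral>\<^sup>+\<omega>. f (case_nat s \<omega>) \<partial>S \<partial>M)"
proof -
  have "(\<integral>\<^sup>+\<omega>. f \<omega> \<partial>S) = (\<integral>\<^sup>+x. f (case_nat (fst x) (snd x)) \<partial>(M \<Otimes>\<^sub>M S))"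
    using assms measurable_iter
    by (subst PiM_iter[symmetric], subst nn_integral_distr) (auto simp: split_beta')
  also have "\<dots> = (\<integral>\<^sup>+s. \<integral>\<^sup>+\<omega>. f (case_nat s \<omega>) \<partial>S \<partial>M)"
    using assms by (subst P.nn_integral_fst[symmetric]) simp_all
  finally show ?thesis .
qed

lemma integrable_iter:
  fixes f :: "(nat \<Rightarrow> 'a) \<Rightarrow> real"
  assumes "f \<in> borel_measurable S"
  shows "integrable S f \<longleftrightarrow> integrable (M \<Otimes>\<^sub>M S) (\<lambda>x. f (case_nat (fst x) (snd x)))"
  using assms measurable_iter
  by (subst (1) PiM_iter[symmetric], subst integrable_distr_eq) (auto simp: split_beta')

lemma integral_iter:
  fixes f :: "(nat \<Rightarrow> 'a) \<Rightarrow> real"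
  assumes "f \<in> borel_measurable S"
  shows "(\<integral>\<omega>. f \<omega> \<partial>S) = (\<integral>x. f (case_nat (fst x) (snd x)) \<partial>(M \<Otimes>\<^sub>M S))"
  using assms measurable_iter
  by (subst (1) PiM_iter[symmetric], subst integral_distr) (auto simp: split_beta')

lemma measurable_walk_max:
  fixes f :: "'a \<Rightarrow> real"
  assumes [measurable]: "f \<in> borel_measurable M"
  shows "walk_max f n \<in> borel_measurable S"
proof (induction n)
  case 0
  then show ?case by simp
next
  case (Suc n)
  note [measurable] = Suc
  have "(\<lambda>\<omega>. \<lambda>k. \<omega> (Suc k)) \<in> S \<rightarrow>\<^sub>M S"
    by (rule measurable_PiM_single') (auto simp: space_PiM)
  then have [measurable]: "(\<lambda>\<omega>. walk_max f n (\<lambda>k. \<omega> (Suc k))) \<in> borel_measurable S"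
    by measurable
  show ?case by simp
qed

lemma walk_max_case_nat:
  "walk_max f (Suc n) (case_nat s \<omega>) = f s + max 0 (walk_max f n \<omega>)"
  by simp

lemma integrable_walk_max:
  assumes f: "integrable M f"
  shows "integrable S (walk_max f n)"
proof (induction n)
  case 0
  have [measurable]: "f \<in> borel_measurable M" using f by simp
  have "integrable (M \<Otimes>\<^sub>M S) (\<lambda>x. f (fst x))" by (rule M_S.integrable_compose_fst[OF f])
  then show ?case by (subst integrable_iter) (auto intro: measurable_walk_max)
next
  case (Suc n)
  have [measurable]: "f \<in> borel_measurable M" using f by simp
  have "integrable (M \<Otimes>\<^sub>M S) (\<lambda>x. f (fst x))" by (rule M_S.integrable_compose_fst[OF f])
  moreover have "integrable (M \<Otimes>\<^sub>M S) (\<lambda>x. max 0 (walk_max f n (snd x)))"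
    by (rule M_S.integrable_compose_snd[of "\<lambda>\<omega>. max 0 (walk_max f n \<omega>)"]) (use Suc in simp)
  ultimately show ?case
    by (subst integrable_iter)
       (use measurable_walk_max[of f "Suc n"] in \<open>auto simp: split_beta'\<close>)
qed

text \<open>
  Let \<open>m\<^sub>n\<close> be the maximum of the first partial sums and \<open>A\<close> the event that these maxima are
  unbounded. \<open>A\<close> is not affected by the first increment, hence independent of it, and
  \<open>m\<^sub>n\<^sub>+\<^sub>1 = f (\<omega> 0) + max 0 m'\<^sub>n\<close> with \<open>m'\<^sub>n\<close> belonging to the shifted sequence. Taking expectations over
  \<open>A\<close>, where \<open>m\<^sub>n \<le> m\<^sub>n\<^sub>+\<^sub>1\<close>, and using that \<open>m\<^sub>n\<close> and \<open>m'\<^sub>n\<close> have the same law, gives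
  \<open>0 \<le> E f \<cdot> P A + E (1\<^sub>A max 0 (- m\<^sub>n))\<close>. The last term tends to 0 because \<open>m\<^sub>n\<close> is eventually
  positive on \<open>A\<close>. As \<open>E f < 0\<close>, it follows that \<open>P A = 0\<close>.
\<close>

lemma random_walk_bounded_above:
  fixes f :: "'a \<Rightarrow> real"
  assumes f: "integrable M f" and neg: "(\<integral>x. f x \<partial>M) < 0"
  shows "AE \<omega> in S. \<exists>C. \<forall>n. (\<Sum>k\<le>n. f (\<omega> k)) \<le> C"
proof -
  have fm[measurable]: "f \<in> borel_measurable M" using f by simp
  note [measurable] = measurable_walk_max[OF fm]
  define A where "A = {\<omega>\<in>space S. \<forall>C::nat. \<exists>n. real C < walk_max f n \<omega>}"
  have A[measurable]: "A \<in> sets S" unfolding A_def by measurable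
  have A_iter: "case_nat s \<omega> \<in> A \<longleftrightarrow> \<omega> \<in> A" if s: "s \<in> space M" and \<omega>: "\<omega> \<in> space S" for s \<omega>
  proof -
    have sp: "case_nat s \<omega> \<in> space S" using s \<omega> by (auto simp: space_PiM PiE_iff split: nat.split)
    show ?thesis
    proof
      assume L: "case_nat s \<omega> \<in> A"
      show "\<omega> \<in> A" unfolding A_def
      proof (safe intro!: \<omega>)
        fix C :: nat
        obtain C' :: nat where C': "real C + \<bar>f s\<bar> \<le> real C'" using real_arch_simple by blast
        obtain n where "real C' < walk_max f n (case_nat s \<omega>)" using L by (auto simp: A_def)
        then have "real C' < f s + max 0 (walk_max f n \<omega>)"
          using walk_max_Suc_ge[of f n "case_nat s \<omega>"] walk_max_case_nat[of f n s \<omega>] by linarith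
        then have "real C < walk_max f n \<omega>" using C' by linarith
        then show "\<exists>n. real C < walk_max f n \<omega>" ..
      qed
    next
      assume R: "\<omega> \<in> A"
      show "case_nat s \<omega> \<in> A" unfolding A_def
      proof (safe intro!: sp)
        fix C :: nat
        obtain C' :: nat where C': "real C + \<bar>f s\<bar> \<le> real C'" using real_arch_simple by blast
        obtain n where "real C' < walk_max f n \<omega>" using R by (auto simp: A_def)
        then have "real C < walk_max f (Suc n) (case_nat s \<omega>)"
          using C' by (subst walk_max_case_nat) linarith
        then show "\<exists>n. real C < walk_max f n (case_nat s \<omega>)" ..
      qed
    qed
  qed
  let ?m = "\<lambda>n. walk_max f n"
  define r where "r n \<omega> = indicator A \<omega> * max 0 (- ?m n \<omega>)" for n \<omega>
  have int_m: "integrable S (?m n)" for n by (rule integrable_walk_max[OF f])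
  have int_Am: "integrable S (\<lambda>\<omega>. indicator A \<omega> * ?m n \<omega>)" for n
    using integrable_mult_indicator[OF A int_m[of n]] by simp
  have int_Amax: "integrable S (\<lambda>\<omega>. indicator A \<omega> * max 0 (?m n \<omega>))" for n
    using integrable_mult_indicator[OF A, of "\<lambda>\<omega>. max 0 (?m n \<omega>)"] int_m[of n] by simp
  have int_r: "integrable S (r n)" for n
    using integrable_mult_indicator[OF A, of "\<lambda>\<omega>. max 0 (- ?m n \<omega>)"] int_m[of n]
    by (simp add: r_def[abs_def])
  \<comment> \<open>\<open>r n\<close> is the excess of \<open>max 0 m\<^sub>n\<close> over \<open>m\<^sub>n\<close>, restricted to \<open>A\<close>.\<close>
  have drift: "0 \<le> (\<integral>x. f x \<partial>M) * measure S A + (\<integral>\<omega>. r n \<omega> \<partial>S)" for n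
  proof -
    have int1: "integrable (M \<Otimes>\<^sub>M S) (\<lambda>x. indicator A (snd x) * f (fst x))"
    proof -
      have "integrable (M \<Otimes>\<^sub>M S) (\<lambda>x. indicator (space M \<times> A) x *\<^sub>R f (fst x))"
        by (rule integrable_mult_indicator[OF _ M_S.integrable_compose_fst[OF f]]) measurable
      also have "?this \<longleftrightarrow> ?thesis"
        by (rule Bochner_Integration.integrable_cong) (auto simp: space_pair_measure indicator_def)
      finally show ?thesis .
    qed
    have int2: "integrable (M \<Otimes>\<^sub>M S) (\<lambda>x. indicator A (snd x) * max 0 (?m n (snd x)))"
      by (rule M_S.integrable_compose_snd[OF int_Amax])
    have "(\<integral>\<omega>. indicator A \<omega> * ?m n \<omega> \<partial>S) \<le> (\<integral>\<omega>. indicator A \<omega> * ?m (Suc n) \<omega> \<partial>S)"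
      by (rule integral_mono[OF int_Am int_Am]) (intro mult_left_mono walk_max_Suc_ge, simp)
    also have "\<dots> = (\<integral>x. indicator A (snd x) * f (fst x) + indicator A (snd x) * max 0 (?m n (snd x)) \<partial>(M \<Otimes>\<^sub>M S))"
    proof (subst integral_iter)
      show "(\<lambda>\<omega>. indicator A \<omega> * ?m (Suc n) \<omega>) \<in> borel_measurable S" by measurable
      show "(\<integral>x. indicator A (case_nat (fst x) (snd x)) * ?m (Suc n) (case_nat (fst x) (snd x)) \<partial>(M \<Otimes>\<^sub>M S))
        = (\<integral>x. indicator A (snd x) * f (fst x) + indicator A (snd x) * max 0 (?m n (snd x)) \<partial>(M \<Otimes>\<^sub>M S))"
        by (intro Bochner_Integration.integral_cong refl)
           (auto simp: space_pair_measure A_iter indicator_def simp del: walk_max.simps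
                 simp add: walk_max_case_nat)
    qed
    also have "\<dots> = (\<integral>x. indicator A (snd x) * f (fst x) \<partial>(M \<Otimes>\<^sub>M S))
        + (\<integral>x. indicator A (snd x) * max 0 (?m n (snd x)) \<partial>(M \<Otimes>\<^sub>M S))"
      by (rule Bochner_Integration.integral_add[OF int1 int2])
    also have "(\<integral>x. indicator A (snd x) * f (fst x) \<partial>(M \<Otimes>\<^sub>M S)) = (\<integral>x. f x \<partial>M) * measure S A"
      by (subst M_S.integral_fst'[symmetric, OF int1]) (simp add: A mult.commute)
    also have "(\<integral>x. indicator A (snd x) * max 0 (?m n (snd x)) \<partial>(M \<Otimes>\<^sub>M S))
        = (\<integral>\<omega>. indicator A \<omega> * max 0 (?m n \<omega>) \<partial>S)"
      by (subst M_S.integral_fst'[symmetric, OF int2]) (simp add: M.prob_space)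
    also have "\<dots> = (\<integral>\<omega>. indicator A \<omega> * ?m n \<omega> + r n \<omega> \<partial>S)"
      by (intro Bochner_Integration.integral_cong refl) (auto simp: r_def indicator_def)
    also have "\<dots> = (\<integral>\<omega>. indicator A \<omega> * ?m n \<omega> \<partial>S) + (\<integral>\<omega>. r n \<omega> \<partial>S)"
      by (rule Bochner_Integration.integral_add[OF int_Am int_r])
    finally show ?thesis by linarith
  qed
  \<comment> \<open>The maxima increase, so the negative part of \<open>m\<^sub>n\<close> is at most that of \<open>m\<^sub>0 = f (\<omega> 0)\<close>.\<close>
  have "(\<lambda>n. \<integral>\<omega>. r n \<omega> \<partial>S) \<longlonglongrightarrow> (\<integral>\<omega>. 0 \<partial>S)"
  proof (rule integral_dominated_convergence[where w="\<lambda>\<omega>. \<bar>f (\<omega> 0)\<bar>"])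
    have "walk_max f 0 = (\<lambda>\<omega>. f (\<omega> 0))" by (simp add: fun_eq_iff)
    then show "integrable S (\<lambda>\<omega>. \<bar>f (\<omega> 0)\<bar>)" using int_m[of 0] by simp
    show "r n \<in> borel_measurable S" for n using int_r by blast
    show "AE \<omega> in S. (\<lambda>n. r n \<omega>) \<longlonglongrightarrow> 0"
    proof (rule AE_I2)
      fix \<omega> assume "\<omega> \<in> space S"
      show "(\<lambda>n. r n \<omega>) \<longlonglongrightarrow> 0"
      proof (cases "\<omega> \<in> A")
        case True
        then obtain N where N: "0 < ?m N \<omega>" unfolding A_def by (auto dest: spec[of _ 0])
        have "r n \<omega> = 0" if "n \<ge> N" for n
          using walk_max_mono[OF that, of f \<omega>] N by (simp add: r_def)
        then show ?thesis by (intro tendsto_eventually eventually_sequentiallyI)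
      qed (simp add: r_def)
    qed
    show "AE \<omega> in S. norm (r n \<omega>) \<le> \<bar>f (\<omega> 0)\<bar>" for n
    proof (rule AE_I2)
      fix \<omega>
      show "norm (r n \<omega>) \<le> \<bar>f (\<omega> 0)\<bar>"
        using walk_max_mono[of 0 n f \<omega>] by (auto simp: r_def indicator_def)
    qed
  qed simp
  then have "(\<lambda>n. (\<integral>x. f x \<partial>M) * measure S A + (\<integral>\<omega>. r n \<omega> \<partial>S)) \<longlonglongrightarrow> (\<integral>x. f x \<partial>M) * measure S A + 0"
    by (intro tendsto_intros) simp
  then have "0 \<le> (\<integral>x. f x \<partial>M) * measure S A + 0"
    by (rule LIMSEQ_le_const) (use drift in blast)
  then have "measure S A = 0"
    using neg by (simp add: zero_le_mult_iff) (metis measure_nonneg antisym)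
  then have "AE \<omega> in S. \<omega> \<notin> A"
    using A by (intro AE_not_in) (simp add: null_sets_def P.emeasure_eq_measure)
  then show ?thesis
  proof (rule AE_mp, intro AE_I2 impI)
    fix \<omega> assume "\<omega> \<in> space S" "\<omega> \<notin> A"
    then obtain C :: nat where C: "\<And>n. \<not> real C < walk_max f n \<omega>" unfolding A_def by blast
    show "\<exists>C. \<forall>n. (\<Sum>k\<le>n. f (\<omega> k)) \<le> C"
      using C partial_sum_le_walk_max[OF order_refl, of f \<omega>] by (meson linorder_not_less order_trans)
  qed
qed

end

text \<open>
  The mean may be \<open>-\<infinity>\<close>, so the increments are replaced by larger ones that are integrable. By monotone convergence the mean
  stays negative if the bound is low enough.
\<close>

lemma (in prob_space) exists_truncation_with_negative_expectation:
  assumes [measurable]: "X \<in> borel_measurable M"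
    and fin: "(\<integral>\<^sup>+x. ennreal (X x) \<partial>M) < \<infinity>" and neg: "ext_expectation M X < 0"
  shows "\<exists>n::nat. integrable M (\<lambda>x. max (X x) (- real n)) \<and> (\<integral>x. max (X x) (- real n) \<partial>M) < 0"
proof (rule ccontr)
  assume contra: "\<not> ?thesis"
  let ?p = "\<integral>\<^sup>+x. ennreal (X x) \<partial>M"
  let ?m = "\<lambda>n::nat. \<integral>\<^sup>+x. ennreal (min (- X x) (real n)) \<partial>M"
  have "?m n \<le> ?p" for n
  proof -
    have pos: "(\<integral>\<^sup>+x. ennreal (max (X x) (- real n)) \<partial>M) = ?p"
      by (intro nn_integral_cong) (auto simp: max_def ennreal_neg)
    have neg: "(\<integral>\<^sup>+x. ennreal (- max (X x) (- real n)) \<partial>M) = ?m n"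
      by (intro nn_integral_cong arg_cong[of _ _ ennreal]) auto
    have "?m n \<le> (\<integral>\<^sup>+x. ennreal (real n) \<partial>M)"
      by (intro nn_integral_mono ennreal_leI) auto
    also have "\<dots> < \<infinity>" by (simp add: emeasure_space_1)
    finally have int: "integrable M (\<lambda>x. max (X x) (- real n))"
      using fin by (auto simp: real_integrable_def pos neg)
    show ?thesis
    proof (rule integrableE[OF int])
      fix r q
      assume rq: "0 \<le> r" "0 \<le> q" "(\<integral>\<^sup>+x. ennreal (max (X x) (- real n)) \<partial>M) = ennreal r"
        "(\<integral>\<^sup>+x. ennreal (- max (X x) (- real n)) \<partial>M) = ennreal q"
        "(\<integral>x. max (X x) (- real n) \<partial>M) = r - q"
      have "0 \<le> (\<integral>x. max (X x) (- real n) \<partial>M)" using contra int by (auto simp: not_less)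
      then have "q \<le> r" using rq(5) by simp
      then show "?m n \<le> ?p" using rq(3,4) unfolding pos neg by (simp add: ennreal_leI)
    qed
  qed
  then have "(SUP n. ?m n) \<le> ?p" by (rule SUP_least)
  also have "(SUP n. ?m n) = (\<integral>\<^sup>+x. (SUP n. ennreal (min (- X x) (real n))) \<partial>M)"
    by (rule nn_integral_monotone_convergence_SUP[symmetric])
       (auto intro!: incseq_SucI ennreal_leI simp: le_fun_def min_def)
  also have "\<dots> = (\<integral>\<^sup>+x. ennreal (- X x) \<partial>M)"
  proof (intro nn_integral_cong antisym SUP_least ennreal_leI)
    fix x
    obtain n :: nat where "- X x \<le> real n" using real_arch_simple by blast
    then have "ennreal (- X x) = ennreal (min (- X x) (real n))" by simp
    also have "\<dots> \<le> (SUP n. ennreal (min (- X x) (real n)))" by (rule SUP_upper) simp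
    finally show "ennreal (- X x) \<le> (SUP n. ennreal (min (- X x) (real n)))" .
  qed simp
  finally have le: "(\<integral>\<^sup>+x. ennreal (- X x) \<partial>M) \<le> ?p" .
  obtain p where p: "0 \<le> p" "?p = ennreal p"
    using fin by (cases ?p rule: ennreal_cases) auto
  obtain m where m: "0 \<le> m" "(\<integral>\<^sup>+x. ennreal (- X x) \<partial>M) = ennreal m"
    using order_le_less_trans[OF le fin] by (cases "\<integral>\<^sup>+x. ennreal (- X x) \<partial>M" rule: ennreal_cases) auto
  have "m \<le> p" using le p m by simp
  then have "0 \<le> ext_expectation M X" using p m by (simp add: ext_expectation_def)
  then show False using neg by simp
qed

section \<open>Paths and their first step\<close>

definition path_sum :: "(nat \<Rightarrow> 'a \<Rightarrow> nat \<Rightarrow> real) \<Rightarrow> 'a \<Rightarrow> nat \<Rightarrow> nat \<Rightarrow> (nat \<Rightarrow> nat) \<Rightarrow> real" where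
  "path_sum W \<omega> j k i =
     (\<Sum>n=k..i j. W n \<omega> j) + (\<Sum>l\<in>{1..<j}. \<Sum>n=i (l + 1) + 1..i l. W n \<omega> l)"

lemma T_eq_SUP_path_sum: "T W j k \<omega> = (SUP i\<in>paths j k. ereal (path_sum W \<omega> j k i))"
  by (simp add: T_def path_sum_def)

lemma T_le_iff_path_sum: "T W j k \<omega> \<le> x \<longleftrightarrow> (\<forall>i\<in>paths j k. ereal (path_sum W \<omega> j k i) \<le> x)"
  by (simp add: T_eq_SUP_path_sum SUP_le_iff)

lemma path_sum_later_start:
  assumes "k < i j"
  shows "path_sum W \<omega> j k i = W k \<omega> j + path_sum W \<omega> j (Suc k) i"
  using assms by (simp add: path_sum_def sum.atLeast_Suc_atMost[of k "i j"])

lemma path_sum_leave_first: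
  assumes "1 \<le> j" "i (Suc j) = k" "\<And>l. l \<in> {1..j} \<Longrightarrow> i l = i' l"
  shows "path_sum W \<omega> (Suc j) k i = W k \<omega> (Suc j) + path_sum W \<omega> j (Suc k) i'"
proof -
  have "(\<Sum>l\<in>{1..<j}. \<Sum>n=i (l + 1) + 1..i l. W n \<omega> l) = (\<Sum>l\<in>{1..<j}. \<Sum>n=i' (l + 1) + 1..i' l. W n \<omega> l)"
    by (rule sum.cong) (auto simp: assms(3))
  then show ?thesis
    using assms by (simp add: path_sum_def)
qed

lemma ereal_add_le_iff: "ereal (a + b) \<le> x \<longleftrightarrow> ereal b \<le> x - ereal a"
  by (cases x) auto

lemma paths_Suc_start_iff: "i \<in> paths j (Suc k) \<longleftrightarrow> i \<in> paths j k \<and> k < i j"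
  by (auto simp: paths_def)

text \<open>
  A path for component 1 that starts at \<open>k\<close> ends there, or it collects the increment at \<open>k\<close> and then is
  a path that starts at \<open>k + 1\<close>.
\<close>

lemma T_1_le_iff:
  "T W 1 k \<omega> \<le> x \<longleftrightarrow> ereal (W k \<omega> 1) \<le> x \<and> T W 1 (Suc k) \<omega> \<le> x - ereal (W k \<omega> 1)"
proof -
  have "(\<forall>i\<in>paths 1 k. ereal (path_sum W \<omega> 1 k i) \<le> x) \<longleftrightarrow>
    (\<forall>i\<in>paths 1 k. i 1 = k \<longrightarrow> ereal (path_sum W \<omega> 1 k i) \<le> x) \<and>
    (\<forall>i\<in>paths 1 (Suc k). ereal (path_sum W \<omega> 1 k i) \<le> x)" (is "_ \<longleftrightarrow> ?now \<and> ?later")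
    unfolding paths_Suc_start_iff by (auto simp: paths_def order_le_less)
  moreover have "?now \<longleftrightarrow> ereal (W k \<omega> 1) \<le> x"
  proof
    assume ?now
    moreover have "(\<lambda>l\<in>{1..1::nat}. k) \<in> paths 1 k" by (auto simp: paths_def)
    ultimately show "ereal (W k \<omega> 1) \<le> x" by (force simp: path_sum_def)
  qed (auto simp: path_sum_def)
  moreover have "?later \<longleftrightarrow> T W 1 (Suc k) \<omega> \<le> x - ereal (W k \<omega> 1)"
    unfolding T_le_iff_path_sum ereal_add_le_iff[symmetric]
    by (intro ball_cong refl) (simp add: paths_Suc_start_iff path_sum_later_start[of k])
  ultimately show ?thesis unfolding T_le_iff_path_sum by simp
qed

text \<open>
  After the increment at \<open>k\<close>, a path for component \<open>j + 1\<close> passes on to component \<open>j\<close> or stays where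
  it is; the remainder is a path of the same kind that starts one index later.
\<close>

lemma T_Suc_le_iff:
  assumes j: "1 \<le> j"
  shows "T W (Suc j) k \<omega> \<le> x \<longleftrightarrow>
    T W j (Suc k) \<omega> \<le> x - ereal (W k \<omega> (Suc j)) \<and>
    T W (Suc j) (Suc k) \<omega> \<le> x - ereal (W k \<omega> (Suc j))"
proof -
  have "(\<forall>i\<in>paths (Suc j) k. ereal (path_sum W \<omega> (Suc j) k i) \<le> x) \<longleftrightarrow>
    (\<forall>i\<in>paths (Suc j) k. i (Suc j) = k \<longrightarrow> ereal (path_sum W \<omega> (Suc j) k i) \<le> x) \<and>
    (\<forall>i\<in>paths (Suc j) (Suc k). ereal (path_sum W \<omega> (Suc j) k i) \<le> x)" (is "_ \<longleftrightarrow> ?now \<and> ?later")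
    unfolding paths_Suc_start_iff by (auto simp: paths_def order_le_less)
  moreover have "?now \<longleftrightarrow> T W j (Suc k) \<omega> \<le> x - ereal (W k \<omega> (Suc j))"
    unfolding T_le_iff_path_sum ereal_add_le_iff[symmetric]
  proof (intro iffI ballI impI)
    fix i assume now: ?now and i: "i \<in> paths j (Suc k)"
    have ij: "Suc k \<le> i j" and less: "\<And>l. l \<in> {1..<j} \<Longrightarrow> i (l + 1) < i l"
      and ext: "i \<in> {1..j} \<rightarrow>\<^sub>E UNIV"
      using i by (auto simp: paths_def)
    define i' where "i' = i(Suc j := k)"
    have "i' \<in> {1..Suc j} \<rightarrow>\<^sub>E UNIV" using ext by (auto simp: i'_def PiE_iff extensional_def)
    moreover have "i' (l + 1) < i' l" if "l \<in> {1..<Suc j}" for l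
      using that ij less[of l] by (cases "l = j") (auto simp: i'_def)
    ultimately have "i' \<in> paths (Suc j) k" by (auto simp: paths_def i'_def)
    moreover have "path_sum W \<omega> (Suc j) k i' = W k \<omega> (Suc j) + path_sum W \<omega> j (Suc k) i"
      by (rule path_sum_leave_first[OF j]) (auto simp: i'_def)
    ultimately show "ereal (W k \<omega> (Suc j) + path_sum W \<omega> j (Suc k) i) \<le> x"
      using now by (metis fun_upd_same i'_def)
  next
    fix i assume *: "\<forall>i\<in>paths j (Suc k). ereal (W k \<omega> (Suc j) + path_sum W \<omega> j (Suc k) i) \<le> x"
      and i: "i \<in> paths (Suc j) k" "i (Suc j) = k"
    have less: "\<And>l. l \<in> {1..<Suc j} \<Longrightarrow> i (l + 1) < i l"
      using i by (auto simp: paths_def)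
    have "restrict i {1..j} \<in> paths j (Suc k)"
      using less[of j] less j i by (auto simp: paths_def)
    moreover have "path_sum W \<omega> (Suc j) k i = W k \<omega> (Suc j) + path_sum W \<omega> j (Suc k) (restrict i {1..j})"
      by (rule path_sum_leave_first[where i=i, OF j i(2)]) auto
    ultimately show "ereal (path_sum W \<omega> (Suc j) k i) \<le> x" using * by simp
  qed
  moreover have "?later \<longleftrightarrow> T W (Suc j) (Suc k) \<omega> \<le> x - ereal (W k \<omega> (Suc j))"
    unfolding T_le_iff_path_sum ereal_add_le_iff[symmetric]
    by (intro ball_cong refl) (simp add: paths_Suc_start_iff path_sum_later_start[of k])
  ultimately show ?thesis unfolding T_le_iff_path_sum by simp
qed

text \<open>
  This is why \<open>\<psi>\<close> solves the equation: the bounds on the suprema starting at \<open>k + 1\<close> for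
  component \<open>j\<close> come from the paths of component \<open>j\<close> that stay and from those of component \<open>j + 1\<close>
  that pass on, and \<open>step\<close> takes the minimum of both.
\<close>

lemma all_T_le_iff_step:
  assumes M: "1 \<le> M"
  shows "(\<forall>j\<in>{1..M}. T W j k \<omega> \<le> v j) \<longleftrightarrow>
    ereal (W k \<omega> 1) \<le> v 1 \<and> (\<forall>j\<in>{1..M}. T W j (Suc k) \<omega> \<le> step M v (W k \<omega>) j)"
proof -
  have range: "{1..M} = insert 1 (Suc ` {1..<M})"
  proof -
    have "m \<in> Suc ` {1..<M}" if "m \<in> {1..M}" "m \<noteq> 1" for m
      using that by (intro image_eqI[of _ _ "m - 1"]) auto
    then show ?thesis using M by auto
  qed
  have range_ball: "(\<forall>j\<in>{1..M}. Q j) \<longleftrightarrow> Q 1 \<and> (\<forall>j\<in>{1..<M}. Q (Suc j))" for Q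
    unfolding range by blast
  let ?a = "\<lambda>j. T W j (Suc k) \<omega> \<le> v j - ereal (W k \<omega> j)"
  let ?b = "\<lambda>j. T W j (Suc k) \<omega> \<le> v (Suc j) - ereal (W k \<omega> (Suc j))"
  have "(\<forall>j\<in>{1..M}. T W j k \<omega> \<le> v j) \<longleftrightarrow>
    T W 1 k \<omega> \<le> v 1 \<and> (\<forall>j\<in>{1..<M}. T W (Suc j) k \<omega> \<le> v (Suc j))"
    by (rule range_ball)
  also have "\<dots> \<longleftrightarrow> ereal (W k \<omega> 1) \<le> v 1 \<and> ?a 1 \<and> (\<forall>j\<in>{1..<M}. ?b j \<and> ?a (Suc j))"
    unfolding T_1_le_iff[of W k] by (auto simp: T_Suc_le_iff[of _ W k])
  also have "?a 1 \<and> (\<forall>j\<in>{1..<M}. ?b j \<and> ?a (Suc j)) \<longleftrightarrow> (\<forall>j\<in>{1..M}. ?a j) \<and> (\<forall>j\<in>{1..<M}. ?b j)"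
    unfolding range_ball[of ?a] by blast
  also have "\<dots> \<longleftrightarrow> (\<forall>j\<in>{1..M}. T W j (Suc k) \<omega> \<le> step M v (W k \<omega>) j)"
    by (auto simp: step_def)
  finally show ?thesis .
qed

text \<open>
  Summation by parts over the switching times. The right-hand side separates the times \<open>i l\<close>:
  each of them is the argument of one random walk of its own, so an upper bound no longer has to
  take the order of the times into account.
\<close>

lemma path_sum_eq_sum_difference_walks:
  assumes "1 \<le> j" "i \<in> paths j 1"
  shows "path_sum W \<omega> j 1 i =
    (\<Sum>l\<in>{1..j}. \<Sum>n=1..i l. W n \<omega> l - (if l = 1 then 0 else W n \<omega> (l - 1)))"
proof -
  define B where "B l m = (if l = 0 then 0 else (\<Sum>n=1..m. W n \<omega> l))" for l m
  have less: "i (l + 1) < i l" if "l \<in> {1..<j}" for l using that assms by (auto simp: paths_def)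
  have telescope: "B j (i j) + (\<Sum>l\<in>{1..<j}. B l (i l) - B l (i (l + 1))) =
    (\<Sum>l\<in>{1..j}. B l (i l) - B (l - 1) (i l))" for j
    by (induction j) (auto simp: B_def atLeastLessThanSuc algebra_simps)
  have "(\<Sum>n=i (l + 1) + 1..i l. W n \<omega> l) = B l (i l) - B l (i (l + 1))" if "l \<in> {1..<j}" for l
  proof -
    have "{1..i l} = {1..i (l + 1)} \<union> {i (l + 1) + 1..i l}" using less[OF that] by auto
    then have "(\<Sum>n=1..i l. W n \<omega> l) = (\<Sum>n=1..i (l + 1). W n \<omega> l) + (\<Sum>n=i (l + 1) + 1..i l. W n \<omega> l)"
      by (simp add: sum.union_disjoint)
    then show ?thesis using that by (simp add: B_def)
  qed
  then have "path_sum W \<omega> j 1 i = B j (i j) + (\<Sum>l\<in>{1..<j}. B l (i l) - B l (i (l + 1)))"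
    using assms(1) by (simp add: path_sum_def B_def)
  also have "\<dots> = (\<Sum>l\<in>{1..j}. \<Sum>n=1..i l. W n \<omega> l - (if l = 1 then 0 else W n \<omega> (l - 1)))"
    unfolding telescope by (intro sum.cong refl) (auto simp: B_def sum_subtractf)
  finally show ?thesis .
qed

lemma path_sum_mono:
  assumes "\<And>n l. l \<in> {1..j} \<Longrightarrow> W n \<omega> l \<le> W' n \<omega>' l" "1 \<le> j"
  shows "path_sum W \<omega> j k i \<le> path_sum W' \<omega>' j k i"
  unfolding path_sum_def using assms(2) by (intro add_mono sum_mono assms(1)) auto

text \<open>
  A basic neighbourhood of \<open>infty_vec M\<close> restricts finitely many components, so the largest of their
  lower bounds serves for all of them. Components outside \<open>{1..M}\<close> are constant on \<open>rbar M\<close>.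
\<close>

lemma eventually_to_infty:
  "eventually Q (to_infty M) \<longleftrightarrow>
    (\<exists>R::real. \<forall>v\<in>rbar M. (\<forall>i\<in>{1..M}. ereal R < v i) \<longrightarrow> v \<noteq> infty_vec M \<longrightarrow> Q v)"
proof
  assume "eventually Q (to_infty M)"
  then obtain U where U: "open U" "infty_vec M \<in> U"
    and Q: "\<And>v. v \<in> U \<Longrightarrow> v \<noteq> infty_vec M \<Longrightarrow> v \<in> rbar M \<Longrightarrow> Q v"
    unfolding eventually_at_topological by auto
  obtain X where X: "infty_vec M \<in> (\<Pi>\<^sub>E i\<in>UNIV. X i)" "\<And>i. open (X i)" "(\<Pi>\<^sub>E i\<in>UNIV. X i) \<subseteq> U"
    using product_topology_open_contains_basis[of "\<lambda>_. euclidean" UNIV U "infty_vec M"] U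
    by (auto simp: open_fun_def)
  have "\<exists>r::real. {ereal r<..} \<subseteq> X i" if "i \<in> {1..M}" for i
  proof -
    have "\<infinity> \<in> X i" using X(1) that by (auto simp: infty_vec_def PiE_iff split: if_splits dest: spec[of _ i])
    then show ?thesis using open_PInfty[OF X(2)[of i]] by blast
  qed
  then obtain r :: "nat \<Rightarrow> real" where r: "\<And>i. i \<in> {1..M} \<Longrightarrow> {ereal (r i)<..} \<subseteq> X i" by metis
  define R where "R = Max (insert 0 (r ` {1..M}))"
  have "Q v" if v: "v \<in> rbar M" "\<And>i. i \<in> {1..M} \<Longrightarrow> ereal R < v i" "v \<noteq> infty_vec M" for v
  proof -
    have "v i \<in> X i" for i
    proof (cases "i \<in> {1..M}")
      case True
      then have "r i \<le> R" unfolding R_def by (intro Max_ge) auto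
      then show ?thesis using r[OF True] v(2)[OF True]
        by (meson ereal_less_eq(3) greaterThan_iff order_le_less_trans subsetD)
    next
      case False
      then have "v i = infty_vec M i" using v(1) by (auto simp: infty_vec_def PiE_def extensional_def)
      then show ?thesis using X(1) by auto
    qed
    then have "v \<in> U" using X(3) by auto
    then show "Q v" using Q v by blast
  qed
  then show "\<exists>R::real. \<forall>v\<in>rbar M. (\<forall>i\<in>{1..M}. ereal R < v i) \<longrightarrow> v \<noteq> infty_vec M \<longrightarrow> Q v" by blast
next
  assume "\<exists>R::real. \<forall>v\<in>rbar M. (\<forall>i\<in>{1..M}. ereal R < v i) \<longrightarrow> v \<noteq> infty_vec M \<longrightarrow> Q v"
  then obtain R :: real where
    R: "\<forall>v\<in>rbar M. (\<forall>i\<in>{1..M}. ereal R < v i) \<longrightarrow> v \<noteq> infty_vec M \<longrightarrow> Q v" ..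
  let ?U = "(\<Inter>i\<in>{1..M}. (\<lambda>v. v i) -` {ereal R<..}) :: (nat \<Rightarrow> ereal) set"
  have "open ?U"
    by (intro open_INT finite_atLeastAtMost ballI open_vimage open_greaterThan continuous_on_product_coordinates)
  moreover have "infty_vec M \<in> ?U" by (auto simp: infty_vec_def)
  moreover have "Q v" if "v \<in> ?U" "v \<noteq> infty_vec M" "v \<in> rbar M" for v
    using R that by simp
  ultimately show "eventually Q (to_infty M)"
    unfolding eventually_at_topological by (intro exI[of _ ?U] conjI ballI impI)
qed

lemma measurable_T:
  assumes W: "\<And>n. 1 \<le> n \<Longrightarrow> W n \<in> P \<rightarrow>\<^sub>M real_vec M" and j: "j \<in> {1..M}"
  shows "(\<lambda>\<omega>. T W j 1 \<omega>) \<in> borel_measurable P"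
  unfolding T_def
proof (rule borel_measurable_SUP)
  have "countable ({1..j} \<rightarrow>\<^sub>E (UNIV :: nat set))" by (intro countable_PiE) auto
  then show "countable (paths j 1)" by (rule countable_subset[rotated]) (auto simp: paths_def)
  fix i
  have [measurable]: "(\<lambda>\<omega>. W n \<omega> l) \<in> borel_measurable P" if "1 \<le> n" "l \<in> {1..M}" for n l
    using measurable_compose[OF W[OF that(1)] measurable_component_singleton[OF that(2)]] .
  have "(\<lambda>\<omega>. (\<Sum>n=1..i j. W n \<omega> j) + (\<Sum>l\<in>{1..<j}. \<Sum>n=i (l + 1) + 1..i l. W n \<omega> l)) \<in> borel_measurable P"
    using j by (intro borel_measurable_add borel_measurable_sum) auto
  then show "(\<lambda>\<omega>. ereal ((\<Sum>n=1..i j. W n \<omega> j) + (\<Sum>l\<in>{1..<j}. \<Sum>n=i (l + 1) + 1..i l. W n \<omega> l))) \<in> borel_measurable P"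
    by simp
qed

text \<open>
  The vector with index 0 never enters a path that starts at index 1.
\<close>

lemma T_cong:
  assumes "\<And>n. 1 \<le> n \<Longrightarrow> W n \<omega> = W' n \<omega>'"
  shows "T W j 1 \<omega> = T W' j 1 \<omega>'"
  unfolding T_eq_SUP_path_sum path_sum_def using assms
  by (intro SUP_cong refl arg_cong[of _ _ ereal] arg_cong2[of _ _ _ _ "(+)"] sum.cong) auto

lemma T_shift:
  assumes "1 \<le> j"
  shows "T W j (Suc k) \<omega> = T (\<lambda>n. W (Suc n)) j k \<omega>"
proof -
  have "paths j (Suc k) = (\<lambda>i. \<lambda>l\<in>{1..j}. Suc (i l)) ` paths j k" (is "_ = ?S ` _")
  proof (intro set_eqI iffI)
    fix i assume i: "i \<in> paths j (Suc k)"
    then have less: "i (l + 1) < i l" if "l \<in> {1..<j}" for l using that by (auto simp: paths_def)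
    have start: "Suc k \<le> i j" using i by (auto simp: paths_def)
    have pos: "1 \<le> i l" if "l \<in> {1..j}" for l
      using less[of l] start that by (cases "l = j") auto
    let ?i = "\<lambda>l\<in>{1..j}. i l - 1"
    have "i (l + 1) - 1 < i l - 1" if "l \<in> {1..<j}" for l
      using less[OF that] pos[of "l + 1"] that by auto
    then have "?i \<in> paths j k"
      using start assms by (auto simp: paths_def)
    moreover have "i = ?S ?i"
    proof
      fix l
      show "i l = ?S ?i l"
        using i pos[of l] by (cases "l \<in> {1..j}") (auto simp: paths_def PiE_iff extensional_def)
    qed
    ultimately show "i \<in> ?S ` paths j k" by blast
  next
    fix i assume "i \<in> ?S ` paths j k"
    then show "i \<in> paths j (Suc k)" using assms by (auto simp: paths_def)
  qed
  moreover have "path_sum W \<omega> j (Suc k) (?S i) = path_sum (\<lambda>n. W (Suc n)) \<omega> j k i" for i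
  proof -
    have "(\<Sum>l\<in>{1..<j}. \<Sum>n=?S i (l + 1) + 1..?S i l. W n \<omega> l) =
      (\<Sum>l\<in>{1..<j}. \<Sum>n=i (l + 1) + 1..i l. W (Suc n) \<omega> l)"
    proof (rule sum.cong[OF refl])
      fix l assume l: "l \<in> {1..<j}"
      have "?S i (l + 1) = Suc (i (l + 1))" "?S i l = Suc (i l)" using l by auto
      then show "(\<Sum>n=?S i (l + 1) + 1..?S i l. W n \<omega> l) = (\<Sum>n=i (l + 1) + 1..i l. W (Suc n) \<omega> l)"
        using sum.shift_bounds_cl_Suc_ivl[of "\<lambda>n. W n \<omega> l" "i (l + 1) + 1" "i l"] by simp
    qed
    moreover have "(\<Sum>n=Suc k..?S i j. W n \<omega> j) = (\<Sum>n=k..i j. W (Suc n) \<omega> j)"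
    proof -
      have "?S i j = Suc (i j)" using assms by simp
      then show ?thesis by (simp only: sum.shift_bounds_cl_Suc_ivl)
    qed
    ultimately show ?thesis unfolding path_sum_def by (simp only:)
  qed
  ultimately show ?thesis unfolding T_eq_SUP_path_sum by (simp add: image_image)
qed

section \<open>The comparison principle\<close>

lemma measurable_step:
  assumes M: "1 \<le> M" and V: "V \<in> P \<rightarrow>\<^sub>M real_vec M"
  shows "(\<lambda>\<omega>. step M v (V \<omega>)) \<in> P \<rightarrow>\<^sub>M ereal_vec M"
  unfolding step_def
proof (rule measurable_restrict)
  have comp[measurable]: "(\<lambda>\<omega>. V \<omega> i) \<in> borel_measurable P" if "i \<in> {1..M}" for i
    using measurable_compose[OF V measurable_component_singleton[OF that]] .
  fix j assume j: "j \<in> {1..M}"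
  note [measurable] = comp[OF j]
  show "(\<lambda>\<omega>. if j < M then min (v j - ereal (V \<omega> j)) (v (j + 1) - ereal (V \<omega> (j + 1)))
      else v M - ereal (V \<omega> M)) \<in> borel_measurable P"
  proof (cases "j < M")
    case True
    have [measurable]: "(\<lambda>\<omega>. V \<omega> (j + 1)) \<in> borel_measurable P" using True by (intro comp) auto
    show ?thesis using True by simp
  next
    case False
    have [measurable]: "(\<lambda>\<omega>. V \<omega> M) \<in> borel_measurable P" using M by (intro comp) auto
    show ?thesis using False by simp
  qed
qed

lemma step_in_rbar: "step M v x \<in> rbar M"
  by (auto simp: step_def)

lemma integrand_cases:
  "integrand M V f v \<omega> = (if ereal (V \<omega> 1) \<le> v 1 then f (step M v (V \<omega>)) else 0)"
  by (simp add: integrand_def)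

lemma measurable_integrand:
  assumes M: "1 \<le> M" and V: "V \<in> P \<rightarrow>\<^sub>M real_vec M" and f: "f \<in> borel_measurable (ereal_vec M)"
  shows "integrand M V f v \<in> borel_measurable P"
proof -
  have [measurable]: "(\<lambda>\<omega>. V \<omega> 1) \<in> borel_measurable P"
    using measurable_compose[OF V measurable_component_singleton[of 1 "{1..M}"]] M by auto
  have [measurable]: "(\<lambda>\<omega>. f (step M v (V \<omega>))) \<in> borel_measurable P"
    by (rule measurable_compose[OF measurable_step[OF M V] f])
  show ?thesis unfolding integrand_cases[abs_def] by measurable
qed

lemma (in prob_space) integrable_integrand_bounded:
  assumes "1 \<le> N" "V \<in> M \<rightarrow>\<^sub>M real_vec N" "f \<in> borel_measurable (ereal_vec N)"
    and B: "\<And>v. v \<in> rbar N \<Longrightarrow> \<bar>f v\<bar> \<le> B"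
  shows "integrable M (integrand N V f v)"
proof (rule integrable_const_bound[where B="\<bar>B\<bar>"])
  show "AE x in M. norm (integrand N V f v x) \<le> \<bar>B\<bar>"
    using B[OF step_in_rbar] by (auto simp: integrand_cases intro: order_trans[OF _ abs_ge_self])
qed (rule measurable_integrand[OF assms(1-3)])

lemma step_le:
  assumes "i \<in> {1..M}" shows "step M v x i \<le> v i - ereal (x i)"
  using assms by (cases "i = M") (auto simp: step_def)

lemma step_le_Suc:
  assumes "i \<in> {1..<M}" shows "step M v x i \<le> v (Suc i) - ereal (x (Suc i))"
  using assms by (auto simp: step_def)

lemma (in prob_space) prob_gt_pos_imp_prob_gt:
  assumes [measurable]: "X \<in> borel_measurable M" and "0 < prob {\<omega>\<in>space M. 0 < X \<omega>}"
  obtains d :: real where "0 < d" "0 < prob {\<omega>\<in>space M. d < X \<omega>}"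
proof -
  let ?A = "\<lambda>n. {\<omega>\<in>space M. 1 / Suc n < X \<omega>}"
  have "incseq ?A"
  proof (rule incseq_SucI, safe)
    fix n \<omega> assume "1 / Suc n < X \<omega>"
    moreover have "1 / real (Suc (Suc n)) \<le> 1 / Suc n" by (simp add: divide_simps)
    ultimately show "1 / Suc (Suc n) < X \<omega>" by linarith
  qed
  then have "(\<lambda>n. prob (?A n)) \<longlonglongrightarrow> prob (\<Union>n. ?A n)"
    by (intro finite_Lim_measure_incseq) auto
  moreover have "(\<Union>n. ?A n) = {\<omega>\<in>space M. 0 < X \<omega>}"
  proof safe
    fix n \<omega> assume "1 / Suc n < X \<omega>" then show "0 < X \<omega>"
      by (meson divide_pos_pos of_nat_0_less_iff order_less_trans zero_less_Suc zero_less_one)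
  next
    fix \<omega> assume "\<omega> \<in> space M" "0 < X \<omega>"
    then show "\<omega> \<in> (\<Union>n. ?A n)" using nat_approx_posE[of "X \<omega>"] by auto
  qed
  ultimately have "eventually (\<lambda>n. 0 < prob (?A n)) sequentially"
    using assms(2) by (auto intro: order_tendstoD)
  then obtain n where "0 < prob (?A n)" by (meson eventually_sequentially order_refl)
  then show ?thesis by (intro that[of "1 / Suc n"]) auto
qed

text \<open>
  The comparison principle in its basic form. If \<open>c\<close> is the supremum of \<open>u\<close> and the integrand is
  at most \<open>(1 - q) c\<close> on an event of probability \<open>p\<close>, then \<open>u \<le> (1 - p q) c\<close> at the starting point.
  This gain propagates: it holds for \<open>v\<^sub>1 \<le> 0\<close>, since \<open>V\<^sub>1 > 0\<close> makes the integrand 0; from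
  \<open>v\<^sub>1 \<le> R\<close> to \<open>v\<^sub>1 \<le> R + d\<close>, since \<open>V\<^sub>1 > d\<close> lowers the first component by \<open>d\<close>; and from component
  \<open>i\<close> to component \<open>i + 1\<close>, since after a step with \<open>V\<^sub>i\<^sub>+\<^sub>1 > 0\<close> the new component \<open>i\<close> lies below the old
  component \<open>i + 1\<close>. Near infinity \<open>u\<close> is small anyway, so \<open>c\<close> cannot be positive.
\<close>

lemma (in prob_space) vanishing_subsolution_le_0:
  fixes u :: "(nat \<Rightarrow> ereal) \<Rightarrow> real"
  assumes N: "1 \<le> N" and V: "V \<in> M \<rightarrow>\<^sub>M real_vec N"
    and pos: "\<And>i. i \<in> {1..N} \<Longrightarrow> 0 < prob {\<omega>\<in>space M. 0 < V \<omega> i}"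
    and u: "u \<in> borel_measurable (ereal_vec N)"
    and u_nonneg: "\<And>v. v \<in> rbar N \<Longrightarrow> 0 \<le> u v" and u_le: "\<And>v. v \<in> rbar N \<Longrightarrow> u v \<le> K"
    and sub: "\<And>v. v \<in> rbar N \<Longrightarrow> u v \<le> (\<integral>\<omega>. integrand N V u v \<omega> \<partial>M)"
    and vanish: "\<And>e. 0 < e \<Longrightarrow> \<exists>R::real. \<forall>v\<in>rbar N. (\<forall>i\<in>{1..N}. ereal R < v i) \<longrightarrow> u v \<le> e"
    and v: "v \<in> rbar N"
  shows "u v \<le> 0"
proof -
  define c where "c = (SUP v\<in>rbar N. u v)"
  have bdd: "bdd_above (u ` rbar N)" using u_le by (rule bdd_aboveI2)
  have u_c: "u w \<le> c" if "w \<in> rbar N" for w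
    unfolding c_def by (rule cSUP_upper[OF that bdd])
  have V_comp: "(\<lambda>\<omega>. V \<omega> i) \<in> borel_measurable M" if "i \<in> {1..N}" for i
    using measurable_compose[OF V measurable_component_singleton[OF that]] .
  have int: "integrable M (integrand N V u w)" for w
    by (rule integrable_integrand_bounded[OF N V u, where B=K]) (use u_nonneg u_le in force)
  have c0: "0 \<le> c" using u_c[OF v] u_nonneg[OF v] by linarith
  have gain: "u w \<le> (1 - prob {\<omega>\<in>space M. d < V \<omega> i} * q) * c"
    if w: "w \<in> rbar N" and i: "i \<in> {1..N}"
      and E: "\<And>\<omega>. d < V \<omega> i \<Longrightarrow> integrand N V u w \<omega> \<le> (1 - q) * c" for w i d q
  proof -
    let ?E = "{\<omega>\<in>space M. d < V \<omega> i}"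
    have [measurable]: "?E \<in> sets M" using V_comp[OF i] by measurable
    have int_E: "integrable M (indicator ?E :: _ \<Rightarrow> real)"
      by (rule integrable_real_indicator) (auto simp: less_top[symmetric])
    have "u w \<le> (\<integral>\<omega>. integrand N V u w \<omega> \<partial>M)" by (rule sub[OF w])
    also have "\<dots> \<le> (\<integral>\<omega>. c - q * c * indicator ?E \<omega> \<partial>M)"
    proof (rule integral_mono[OF int])
      fix \<omega> assume "\<omega> \<in> space M"
      then show "integrand N V u w \<omega> \<le> c - q * c * indicator ?E \<omega>"
        using E[of \<omega>] u_c[OF step_in_rbar] c0
        by (cases "d < V \<omega> i") (auto simp: algebra_simps integrand_cases[of N V u])
    qed (use int_E in simp)
    also have "\<dots> = (1 - prob ?E * q) * c"
      using int_E by (subst Bochner_Integration.integral_diff) (simp_all add: prob_space algebra_simps)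
    finally show ?thesis .
  qed
  have integrand_le: "integrand N V u w \<omega> \<le> u (step N w (V \<omega>))" for w \<omega>
    using u_nonneg[OF step_in_rbar] by (simp add: integrand_cases)
  have bounded_away: "\<exists>q>0. \<forall>w\<in>rbar N. w i \<le> ereal R \<longrightarrow> u w \<le> (1 - q) * c"
    if "i \<in> {1..N}" for i R
    using that
  proof (induction i arbitrary: R)
    case (Suc i)
    show ?case
    proof (cases "i = 0")
      case True
      have one: "(1::nat) \<in> {1..N}" using N by simp
      obtain d where d: "0 < d" "0 < prob {\<omega>\<in>space M. d < V \<omega> 1}"
        using prob_gt_pos_imp_prob_gt[OF V_comp[OF one] pos[OF one]] .
      have "\<exists>q>0. \<forall>w\<in>rbar N. w 1 \<le> ereal (real n * d) \<longrightarrow> u w \<le> (1 - q) * c" for n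
      proof (induction n)
        case 0
        have "u w \<le> (1 - prob {\<omega>\<in>space M. d < V \<omega> 1} * 1) * c" if "w \<in> rbar N" "w 1 \<le> 0" for w
        proof (rule gain[OF that(1) one])
          fix \<omega> assume "d < V \<omega> 1"
          then have "\<not> ereal (V \<omega> 1) \<le> w 1" using that(2) d(1)
            by (metis dual_order.strict_trans ereal_less(2) leD order_trans)
          then show "integrand N V u w \<omega> \<le> (1 - 1) * c" by (simp add: integrand_cases)
        qed
        then show ?case using d(2) by (intro exI[of _ "prob {\<omega>\<in>space M. d < V \<omega> 1}"]) (auto simp: zero_ereal_def)
      next
        case (Suc n)
        then obtain q where q: "0 < q" "\<And>w. w \<in> rbar N \<Longrightarrow> w 1 \<le> ereal (real n * d) \<Longrightarrow> u w \<le> (1 - q) * c"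
          by blast
        have "u w \<le> (1 - prob {\<omega>\<in>space M. d < V \<omega> 1} * q) * c"
          if w: "w \<in> rbar N" "w 1 \<le> ereal (real (Suc n) * d)" for w
        proof (rule gain[OF w(1) one])
          fix \<omega> assume \<omega>: "d < V \<omega> 1"
          have "step N w (V \<omega>) 1 \<le> w 1 - ereal (V \<omega> 1)" by (rule step_le[OF one])
          also have "\<dots> \<le> ereal (real (Suc n) * d) - ereal d"
            using w(2) \<omega> by (intro ereal_minus_mono) auto
          also have "\<dots> = ereal (real n * d)" by (simp add: algebra_simps)
          finally have "u (step N w (V \<omega>)) \<le> (1 - q) * c" by (rule q(2)[OF step_in_rbar])
          then show "integrand N V u w \<omega> \<le> (1 - q) * c"
            using integrand_le order_trans by blast
        qed
        then show ?case using d(2) q(1)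
          by (intro exI[of _ "prob {\<omega>\<in>space M. d < V \<omega> 1} * q"]) auto
      qed
      moreover obtain n :: nat where "R \<le> real n * d"
        using reals_Archimedean3[OF d(1)] by (meson less_imp_le)
      ultimately show ?thesis unfolding True One_nat_def[symmetric]
        by (meson ereal_less_eq(3) order_trans)
    next
      case False
      then have i: "i \<in> {1..N}" "i \<in> {1..<N}" using Suc.prems by auto
      obtain q where q: "0 < q" "\<And>w. w \<in> rbar N \<Longrightarrow> w i \<le> ereal R \<Longrightarrow> u w \<le> (1 - q) * c"
        using Suc.IH[OF i(1)] by blast
      have "u w \<le> (1 - prob {\<omega>\<in>space M. 0 < V \<omega> (Suc i)} * q) * c"
        if w: "w \<in> rbar N" "w (Suc i) \<le> ereal R" for w
      proof (rule gain[OF w(1) Suc.prems])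
        fix \<omega> assume \<omega>: "0 < V \<omega> (Suc i)"
        have "step N w (V \<omega>) i \<le> w (Suc i) - ereal (V \<omega> (Suc i))" by (rule step_le_Suc[OF i(2)])
        also have "\<dots> \<le> ereal R - ereal 0"
          using w(2) \<omega> by (intro ereal_minus_mono) auto
        finally have "u (step N w (V \<omega>)) \<le> (1 - q) * c" by (intro q(2)[OF step_in_rbar]) simp
        then show "integrand N V u w \<omega> \<le> (1 - q) * c"
          using integrand_le order_trans by blast
      qed
      then show ?thesis using pos[OF Suc.prems] q(1)
        by (intro exI[of _ "prob {\<omega>\<in>space M. 0 < V \<omega> (Suc i)} * q"]) auto
    qed
  qed simp
  have "c \<le> 0"
  proof (rule ccontr)
    assume "\<not> c \<le> 0"
    then have c: "0 < c" by simp
    obtain R :: real where R: "\<And>w. w \<in> rbar N \<Longrightarrow> \<forall>i\<in>{1..N}. ereal R < w i \<Longrightarrow> u w \<le> c / 2"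
      using vanish[of "c / 2"] c by auto
    obtain q where q: "\<And>i. i \<in> {1..N} \<Longrightarrow> 0 < q i"
      "\<And>i w. i \<in> {1..N} \<Longrightarrow> w \<in> rbar N \<Longrightarrow> w i \<le> ereal R \<Longrightarrow> u w \<le> (1 - q i) * c"
      using bounded_away[of _ R] by metis
    define q0 where "q0 = Min (q ` {1..N})"
    have q0: "0 < q0" using q(1) N by (auto simp: q0_def)
    have "u w \<le> max (c / 2) ((1 - q0) * c)" if w: "w \<in> rbar N" for w
    proof (cases "\<forall>i\<in>{1..N}. ereal R < w i")
      case False
      then obtain i where i: "i \<in> {1..N}" "w i \<le> ereal R" by force
      have "u w \<le> (1 - q i) * c" by (rule q(2)[OF i(1) w i(2)])
      also have "\<dots> \<le> (1 - q0) * c"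
        using i(1) c by (intro mult_right_mono) (auto simp: q0_def)
      finally show ?thesis by simp
    qed (use R[OF w] in auto)
    then have "c \<le> max (c / 2) ((1 - q0) * c)"
      unfolding c_def using v by (intro cSUP_least) auto
    moreover have "(1 - q0) * c < c" using q0 c by (simp add: algebra_simps)
    ultimately show False using c by (auto simp: max_def split: if_splits)
  qed
  then show ?thesis using u_c[OF v] by linarith
qed

lemma ext_expectation_integrable:
  assumes "integrable P X"
  shows "ext_expectation P X = ereal (\<integral>x. X x \<partial>P)"
proof -
  obtain r q where rq: "0 \<le> r" "0 \<le> q" "(\<integral>\<^sup>+x. ennreal (X x) \<partial>P) = ennreal r"
    "(\<integral>\<^sup>+x. ennreal (- X x) \<partial>P) = ennreal q" "(\<integral>x. X x \<partial>P) = r - q"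
    using integrableE[OF assms] by metis
  then show ?thesis by (simp add: ext_expectation_def)
qed

text \<open>
  At the points where the inequalities for \<open>\<gamma>\<close> and \<open>\<eta>\<close> are imposed, they exclude infinite
  expectations; this lemma and the next one thus make the Bochner integral available there.
\<close>

lemma ext_expectation_ge_imp_integrable:
  assumes [measurable]: "X \<in> borel_measurable P"
    and fin: "(\<integral>\<^sup>+x. ennreal (X x) \<partial>P) < \<infinity>" and ge: "ereal r \<le> ext_expectation P X"
  shows "integrable P X"
proof -
  have "(\<integral>\<^sup>+x. ennreal (- X x) \<partial>P) \<noteq> \<infinity>"
  proof
    assume inf: "(\<integral>\<^sup>+x. ennreal (- X x) \<partial>P) = \<infinity>"
    obtain a where a: "0 \<le> a" "(\<integral>\<^sup>+x. ennreal (X x) \<partial>P) = ennreal a"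
      using fin by (cases "\<integral>\<^sup>+x. ennreal (X x) \<partial>P" rule: ennreal_cases) auto
    have "ext_expectation P X = - \<infinity>" using a by (simp add: ext_expectation_def inf)
    then show False using ge by simp
  qed
  then show ?thesis using fin by (simp add: real_integrable_def)
qed

lemma ext_expectation_le_imp_integrable:
  assumes [measurable]: "X \<in> borel_measurable P"
    and nonneg: "\<And>x. 0 \<le> X x" and le: "ext_expectation P X \<le> ereal r"
  shows "integrable P X"
proof -
  have neg: "(\<integral>\<^sup>+x. ennreal (- X x) \<partial>P) = 0" using nonneg by (simp add: ennreal_neg)
  have "(\<integral>\<^sup>+x. ennreal (X x) \<partial>P) \<noteq> \<infinity>"
    using le by (auto simp: ext_expectation_def neg)
  then show ?thesis using neg by (simp add: real_integrable_def)
qed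

text \<open>
  Where \<open>\<gamma> > \<psi>\<close>, the value of \<open>\<gamma>\<close> is positive because \<open>\<psi> \<ge> 0\<close>. Hence the
  subsolution inequality holds at all points where \<open>max 0 (\<gamma> - \<psi>)\<close> is positive, and this function
  satisfies the hypotheses of the comparison principle.
\<close>

lemma (in prob_space) subsolution_le_nonneg_solution:
  fixes \<gamma> :: "(nat \<Rightarrow> ereal) \<Rightarrow> real"
  assumes N: "1 \<le> N" and V: "V \<in> M \<rightarrow>\<^sub>M real_vec N"
    and pos: "\<And>i. i \<in> {1..N} \<Longrightarrow> 0 < prob {\<omega>\<in>space M. 0 < V \<omega> i}"
    and sol: "solution M N V \<psi>" and nonneg: "\<And>v. v \<in> rbar N \<Longrightarrow> 0 \<le> \<psi> v"
    and \<gamma>: "\<gamma> \<in> borel_measurable (ereal_vec N)"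
    and K: "\<And>v. v \<in> rbar N \<Longrightarrow> \<gamma> v \<le> K"
    and sub: "\<And>v. v \<in> rbar N \<Longrightarrow> 0 < \<gamma> v \<Longrightarrow> ereal (\<gamma> v) \<le> ext_expectation M (integrand N V \<gamma> v)"
    and infty: "\<gamma> (infty_vec N) = 1"
    and limit: "\<And>e. 0 < e \<Longrightarrow> eventually (\<lambda>v. \<gamma> v < 1 + e) (to_infty N)"
    and v: "v \<in> rbar N"
  shows "\<gamma> v \<le> \<psi> v"
proof -
  have \<psi>: "\<psi> \<in> borel_measurable (ereal_vec N)" "\<psi> (infty_vec N) = 1" "(\<psi> \<longlongrightarrow> 1) (to_infty N)"
    and eq: "\<And>v. v \<in> rbar N \<Longrightarrow> (\<integral>\<omega>. integrand N V \<psi> v \<omega> \<partial>M) = \<psi> v"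
    using sol by (auto simp: solution_def)
  obtain B where B: "\<And>v. v \<in> rbar N \<Longrightarrow> \<bar>\<psi> v\<bar> \<le> B" using sol by (auto simp: solution_def)
  define u where "u v = max 0 (\<gamma> v - \<psi> v)" for v
  have u[measurable]: "u \<in> borel_measurable (ereal_vec N)" unfolding u_def using \<gamma> \<psi>(1) by measurable
  have u_bounds: "0 \<le> u v" "u v \<le> max 0 K" if "v \<in> rbar N" for v
    using K[OF that] nonneg[OF that] by (auto simp: u_def)
  have int_\<psi>: "integrable M (integrand N V \<psi> v)" for v
    by (rule integrable_integrand_bounded[OF N V \<psi>(1) B])
  have int_u: "integrable M (integrand N V u v)" for v
    by (rule integrable_integrand_bounded[OF N V u, where B="max 0 K"]) (use u_bounds in force)
  have "u v \<le> 0"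
  proof (rule vanishing_subsolution_le_0[OF N V pos u u_bounds _ _ v])
    fix v assume v: "v \<in> rbar N"
    show "u v \<le> (\<integral>\<omega>. integrand N V u v \<omega> \<partial>M)"
    proof (cases "\<psi> v < \<gamma> v")
      case True
      then have pos: "0 < \<gamma> v" using nonneg[OF v] by linarith
      have fin: "(\<integral>\<^sup>+\<omega>. ennreal (integrand N V \<gamma> v \<omega>) \<partial>M) < \<infinity>"
      proof -
        have "(\<integral>\<^sup>+\<omega>. ennreal (integrand N V \<gamma> v \<omega>) \<partial>M) \<le> (\<integral>\<^sup>+\<omega>. ennreal \<bar>K\<bar> \<partial>M)"
          using K[OF step_in_rbar]
          by (intro nn_integral_mono ennreal_leI) (auto simp: integrand_cases intro: order_trans[OF _ abs_ge_self])
        also have "\<dots> < \<infinity>" by (simp add: emeasure_space_1)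
        finally show ?thesis .
      qed
      have int_\<gamma>: "integrable M (integrand N V \<gamma> v)"
        by (rule ext_expectation_ge_imp_integrable[OF measurable_integrand[OF N V \<gamma>] fin sub[OF v pos]])
      have "u v = \<gamma> v - \<psi> v" using True by (simp add: u_def)
      also have "\<dots> \<le> (\<integral>\<omega>. integrand N V \<gamma> v \<omega> \<partial>M) - (\<integral>\<omega>. integrand N V \<psi> v \<omega> \<partial>M)"
        using sub[OF v pos] by (simp add: ext_expectation_integrable[OF int_\<gamma>] eq[OF v])
      also have "\<dots> = (\<integral>\<omega>. integrand N V \<gamma> v \<omega> - integrand N V \<psi> v \<omega> \<partial>M)"
        using int_\<gamma> int_\<psi> by simp
      also have "\<dots> \<le> (\<integral>\<omega>. integrand N V u v \<omega> \<partial>M)"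
        by (rule integral_mono[OF Bochner_Integration.integrable_diff[OF int_\<gamma> int_\<psi>] int_u])
           (auto simp: integrand_cases u_def)
      finally show ?thesis .
    next
      case False
      then have "u v = 0" by (simp add: u_def)
      also have "0 \<le> (\<integral>\<omega>. integrand N V u v \<omega> \<partial>M)"
        using u_bounds(1)[OF step_in_rbar] by (intro integral_nonneg_AE AE_I2) (simp add: integrand_cases)
      finally show ?thesis .
    qed
  next
    fix e :: real assume e: "0 < e"
    have "eventually (\<lambda>v. 1 - e / 2 < \<psi> v) (to_infty N)"
      using \<psi>(3) e by (intro order_tendstoD) auto
    moreover have "eventually (\<lambda>v. \<gamma> v < 1 + e / 2) (to_infty N)"
      using e by (intro limit) simp
    ultimately have "eventually (\<lambda>v. u v \<le> e) (to_infty N)"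
      by eventually_elim (use e in \<open>auto simp: u_def\<close>)
    moreover have "u (infty_vec N) \<le> e" using infty \<psi>(2) e by (simp add: u_def)
    ultimately show "\<exists>R::real. \<forall>v\<in>rbar N. (\<forall>i\<in>{1..N}. ereal R < v i) \<longrightarrow> u v \<le> e"
      unfolding eventually_to_infty by metis
  qed
  then show ?thesis by (simp add: u_def)
qed

section \<open>The law of the suprema solves the equation\<close>

text \<open>
  Sequences in the product space start with index 0, whereas the random vectors are numbered from 1.
\<close>

definition coord :: "nat \<Rightarrow> (nat \<Rightarrow> 'a) \<Rightarrow> 'a" where
  "coord n \<omega> = \<omega> (n - 1)"

lemma T_coord_iter:
  assumes "1 \<le> j"
  shows "T coord j (Suc 1) (case_nat s \<omega>) = T coord j 1 \<omega>"
  unfolding T_shift[OF assms]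
  by (rule T_cong) (auto simp: coord_def split: nat.split)

locale iid_vectors = sequence_space D for D :: "(nat \<Rightarrow> real) measure" +
  fixes N :: nat
  assumes N: "1 \<le> N" and sets_D[measurable_cong]: "sets D = sets (real_vec N)"
begin

lemma space_D: "space D = space (real_vec N)"
  using sets_D by (rule sets_eq_imp_space_eq)

lemma measurable_coord: "coord n \<in> S \<rightarrow>\<^sub>M real_vec N"
  unfolding coord_def[abs_def] by measurable

lemma measurable_T_coord: "j \<in> {1..N} \<Longrightarrow> T coord j 1 \<in> borel_measurable S"
  by (rule measurable_T) (rule measurable_coord)

lemma measurable_component_D: "i \<in> {1..N} \<Longrightarrow> (\<lambda>x. x i) \<in> borel_measurable D"
  by measurable

lemma measurable_T_coord_le: "{\<omega>\<in>space S. \<forall>j\<in>{1..N}. T coord j 1 \<omega> \<le> v j} \<in> sets S"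
proof -
  note [measurable] = measurable_T_coord
  show ?thesis by measurable
qed

text \<open>
  The increments are replaced by larger ones, \<open>g i\<close>, with mean \<open>- m i / N\<close>. These means decrease in \<open>i\<close>
  with constant difference, so that the difference walks have mean \<open>- m / N\<close> and are bounded above.
\<close>

lemma T_coord_less_top:
  assumes fin: "\<And>i. i \<in> {1..N} \<Longrightarrow> (\<integral>\<^sup>+x. ennreal (x i) \<partial>D) < \<infinity>"
    and neg: "\<And>i. i \<in> {1..N} \<Longrightarrow> ext_expectation D (\<lambda>x. x i) < 0"
  shows "AE \<omega> in S. \<forall>j\<in>{1..N}. T coord j 1 \<omega> < \<infinity>"
proof -
  have "\<exists>n::nat. integrable D (\<lambda>x. max (x i) (- real n)) \<and> (\<integral>x. max (x i) (- real n) \<partial>D) < 0"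
    if "i \<in> {1..N}" for i
    by (rule M.exists_truncation_with_negative_expectation[OF measurable_component_D[OF that] fin[OF that] neg[OF that]])
  then obtain n :: "nat \<Rightarrow> nat" where
    n: "\<And>i. i \<in> {1..N} \<Longrightarrow> integrable D (\<lambda>x. max (x i) (- real (n i)))"
      "\<And>i. i \<in> {1..N} \<Longrightarrow> (\<integral>x. max (x i) (- real (n i)) \<partial>D) < 0"
    by metis
  define E where "E i = (\<integral>x. max (x i) (- real (n i)) \<partial>D)" for i
  define m where "m = Min ((\<lambda>i. - E i) ` {1..N})"
  have m: "0 < m" using n(2) N by (auto simp: m_def E_def)
  have m_le: "m \<le> - E i" if "i \<in> {1..N}" for i using that by (simp add: m_def)
  \<comment> \<open>As \<open>E i \<le> - m \<le> - m i / N\<close>, the correction of the mean is an upward shift.\<close>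
  define g where "g i x = max (x i) (- real (n i)) - E i - m * i / N" for i and x :: "nat \<Rightarrow> real"
  have g_ge: "x i \<le> g i x" if "i \<in> {1..N}" for x i
  proof -
    have "m * i / N \<le> m" using that m by (simp add: field_simps)
    then show ?thesis using m_le[OF that] by (simp add: g_def)
  qed
  have int_g: "integrable D (g i)" if "i \<in> {1..N}" for i
    unfolding g_def[abs_def] using n(1)[OF that] by simp
  have E_g: "(\<integral>x. g i x \<partial>D) = - m * i / N" if "i \<in> {1..N}" for i
    unfolding g_def using n(1)[OF that] by (simp add: E_def M.prob_space)
  define h where "h i x = g i x - (if i = 1 then 0 else g (i - 1) x)" for i x
  have "AE \<omega> in S. \<exists>C. \<forall>n. (\<Sum>k\<le>n. h i (\<omega> k)) \<le> C" if i: "i \<in> {1..N}" for i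
  proof (rule random_walk_bounded_above)
    have prev: "i - 1 \<in> {1..N}" if "i \<noteq> 1" using that i by auto
    show "integrable D (h i)"
      unfolding h_def[abs_def] using int_g[OF i] int_g[OF prev] by (cases "i = 1") simp_all
    have "(\<integral>x. h i x \<partial>D) = - m / N"
    proof (cases "i = 1")
      case False
      have "(\<integral>x. h i x \<partial>D) = (\<integral>x. g i x \<partial>D) - (\<integral>x. g (i - 1) x \<partial>D)"
        unfolding h_def using False int_g[OF i] int_g[OF prev[OF False]] by simp
      also have "\<dots> = - m / N"
        using i unfolding E_g[OF i] E_g[OF prev[OF False]] by (auto simp: of_nat_diff field_simps)
      finally show ?thesis .
    qed (use E_g[OF i] in \<open>simp add: h_def\<close>)
    then show "(\<integral>x. h i x \<partial>D) < 0" using m N by simp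
  qed
  then have "AE \<omega> in S. \<forall>i\<in>{1..N}. \<exists>C. \<forall>n. (\<Sum>k\<le>n. h i (\<omega> k)) \<le> C"
    by (intro AE_finite_allI) auto
  then show ?thesis
  proof (rule AE_mp, intro AE_I2 impI ballI)
    fix \<omega> :: "nat \<Rightarrow> nat \<Rightarrow> real" and j
    assume "\<forall>i\<in>{1..N}. \<exists>C. \<forall>n::nat. (\<Sum>k\<le>n. h i (\<omega> k)) \<le> C" and j: "j \<in> {1..N}"
    then obtain C where C: "\<And>i n. i \<in> {1..N} \<Longrightarrow> (\<Sum>k\<le>n. h i (\<omega> k)) \<le> C i" by metis
    define Y where "Y n \<omega> l = g l (coord n \<omega>)" for n l and \<omega> :: "nat \<Rightarrow> nat \<Rightarrow> real"
    have "T coord j 1 \<omega> \<le> ereal (\<Sum>l\<in>{1..j}. C l)"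
      unfolding T_le_iff_path_sum
    proof
      fix i assume i: "i \<in> paths j 1"
      have less: "i (l + 1) < i l" if "l \<in> {1..<j}" for l using that i by (auto simp: paths_def)
      have start: "1 \<le> i j" using i by (auto simp: paths_def)
      have pos: "1 \<le> i l" if "l \<in> {1..j}" for l
        using less[of l] start that by (cases "l = j") auto
      have "path_sum coord \<omega> j 1 i \<le> path_sum Y \<omega> j 1 i"
        using j by (intro path_sum_mono) (auto simp: Y_def intro!: g_ge)
      also have "\<dots> = (\<Sum>l\<in>{1..j}. \<Sum>n=1..i l. h l (coord n \<omega>))"
        using j i by (subst path_sum_eq_sum_difference_walks) (auto simp: Y_def h_def cong: if_cong)
      also have "\<dots> \<le> (\<Sum>l\<in>{1..j}. C l)"
      proof (rule sum_mono)
        fix l assume l: "l \<in> {1..j}"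
        obtain k where k: "i l = Suc k" using pos[OF l] by (cases "i l") auto
        have "(\<Sum>n=1..i l. h l (coord n \<omega>)) = (\<Sum>n\<le>k. h l (\<omega> n))"
          unfolding k One_nat_def sum.shift_bounds_cl_Suc_ivl by (simp add: coord_def atMost_atLeast0)
        also have "\<dots> \<le> C l" using l j by (intro C) auto
        finally show "(\<Sum>n=1..i l. h l (coord n \<omega>)) \<le> C l" .
      qed
      finally show "ereal (path_sum coord \<omega> j 1 i) \<le> ereal (\<Sum>l\<in>{1..j}. C l)" by simp
    qed
    also have "\<dots> < \<infinity>" by simp
    finally show "T coord j 1 \<omega> < \<infinity>" .
  qed
qed

lemma psi_eq_nn_integral:
  "ennreal (psi S N coord v) = (\<integral>\<^sup>+x. ennreal (integrand N (\<lambda>x. x) (psi S N coord) v x) \<partial>D)"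
proof -
  let ?A = "\<lambda>v. {\<omega>\<in>space S. \<forall>j\<in>{1..N}. T coord j 1 \<omega> \<le> v j}"
  have psi: "ennreal (psi S N coord v) = emeasure S (?A v)" for v
    by (simp add: psi_def P.emeasure_eq_measure)
  have "emeasure S (?A v) = (\<integral>\<^sup>+x. \<integral>\<^sup>+\<omega>. indicator (?A v) (case_nat x \<omega>) \<partial>S \<partial>D)"
    using measurable_T_coord_le[of v] by (simp add: nn_integral_iter[symmetric])
  also have "\<dots> = (\<integral>\<^sup>+x. ennreal (integrand N (\<lambda>x. x) (psi S N coord) v x) \<partial>D)"
  proof (rule nn_integral_cong)
    fix x assume x: "x \<in> space D"
    have "case_nat x \<omega> \<in> ?A v \<longleftrightarrow> ereal (x 1) \<le> v 1 \<and> \<omega> \<in> ?A (step N v x)" if "\<omega> \<in> space S" for \<omega>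
    proof -
      have "case_nat x \<omega> \<in> space S" using x that by (auto simp: space_PiM PiE_iff split: nat.split)
      moreover have "coord 1 (case_nat x \<omega>) = x" by (simp add: coord_def)
      ultimately show ?thesis
        using that all_T_le_iff_step[OF N, of coord 1 "case_nat x \<omega>" v] T_coord_iter[of _ x \<omega>] by auto
    qed
    then have "(\<integral>\<^sup>+\<omega>. indicator (?A v) (case_nat x \<omega>) \<partial>S) =
      (\<integral>\<^sup>+\<omega>. indicator {x. ereal (x 1) \<le> v 1} x * indicator (?A (step N v x)) \<omega> \<partial>S)"
      by (intro nn_integral_cong) (auto simp: indicator_def)
    also have "\<dots> = indicator {x. ereal (x 1) \<le> v 1} x * emeasure S (?A (step N v x))"
      using measurable_T_coord_le by (simp add: nn_integral_cmult)
    also have "\<dots> = ennreal (integrand N (\<lambda>x. x) (psi S N coord) v x)"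
      by (simp add: integrand_cases psi indicator_def)
    finally show "(\<integral>\<^sup>+\<omega>. indicator (?A v) (case_nat x \<omega>) \<partial>S) =
      ennreal (integrand N (\<lambda>x. x) (psi S N coord) v x)" .
  qed
  finally show ?thesis by (simp add: psi)
qed

lemma measurable_psi: "psi S N coord \<in> borel_measurable (ereal_vec N)"
proof -
  let ?Q = "{x \<in> space (ereal_vec N \<Otimes>\<^sub>M S). \<forall>j\<in>{1..N}. T coord j 1 (snd x) \<le> fst x j}"
  have "{x \<in> space (ereal_vec N \<Otimes>\<^sub>M S). T coord j 1 (snd x) \<le> fst x j} \<in> sets (ereal_vec N \<Otimes>\<^sub>M S)"
    if j: "j \<in> {1..N}" for j
    by (intro borel_measurable_le measurable_compose[OF measurable_snd measurable_T_coord[OF j]]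
        measurable_compose[OF measurable_fst measurable_component_singleton[OF j]])
  then have "?Q \<in> sets (ereal_vec N \<Otimes>\<^sub>M S)"
    by (intro sets.sets_Collect_finite_All) auto
  then have "(\<lambda>v. emeasure S (Pair v -` ?Q)) \<in> borel_measurable (ereal_vec N)"
    by (rule P.measurable_emeasure_Pair)
  then have "(\<lambda>v. measure S (Pair v -` ?Q)) \<in> borel_measurable (ereal_vec N)"
    unfolding measure_def by measurable
  also have "?this \<longleftrightarrow> ?thesis"
    unfolding psi_def
    by (intro measurable_cong arg_cong[of _ _ "measure S"]) (auto simp: space_pair_measure)
  finally show ?thesis .
qed

lemma psi_tendsto_1:
  assumes fin: "\<And>i. i \<in> {1..N} \<Longrightarrow> (\<integral>\<^sup>+x. ennreal (x i) \<partial>D) < \<infinity>"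
    and neg: "\<And>i. i \<in> {1..N} \<Longrightarrow> ext_expectation D (\<lambda>x. x i) < 0"
  shows "(psi S N coord \<longlongrightarrow> 1) (to_infty N)"
proof (rule order_tendstoI)
  let ?A = "\<lambda>n::nat. {\<omega>\<in>space S. \<forall>j\<in>{1..N}. T coord j 1 \<omega> \<le> ereal n}"
  have meas: "?A n \<in> sets S" for n by (rule measurable_T_coord_le)
  have "incseq ?A"
    by (rule incseq_SucI) (auto intro: order_trans)
  then have "(\<lambda>n. measure S (?A n)) \<longlonglongrightarrow> measure S (\<Union>n. ?A n)"
    using meas by (intro P.finite_Lim_measure_incseq) auto
  moreover have "measure S (\<Union>n. ?A n) = 1"
  proof (subst P.prob_eq_1)
    have "AE \<omega> in S. \<forall>j\<in>{1..N}. T coord j 1 \<omega> < \<infinity>"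
      by (rule T_coord_less_top[OF fin neg])
    then show "AE \<omega> in S. \<omega> \<in> (\<Union>n. ?A n)"
    proof (rule AE_mp, intro AE_I2 impI)
      fix \<omega> assume \<omega>: "\<omega> \<in> space S" and *: "\<forall>j\<in>{1..N}. T coord j 1 \<omega> < \<infinity>"
      have "\<exists>n::nat. T coord j 1 \<omega> \<le> ereal n" if "j \<in> {1..N}" for j
      proof -
        have "T coord j 1 \<omega> \<noteq> \<infinity>" using *[rule_format, OF that] by simp
        then show ?thesis unfolding less_PInf_Ex_of_nat by (blast intro: less_imp_le)
      qed
      then obtain n :: "nat \<Rightarrow> nat" where n: "\<And>j. j \<in> {1..N} \<Longrightarrow> T coord j 1 \<omega> \<le> ereal (n j)" by metis
      have "T coord j 1 \<omega> \<le> ereal (Max (n ` {1..N}))" if j: "j \<in> {1..N}" for j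
      proof -
        have "n j \<le> Max (n ` {1..N})" using j by (intro Max_ge) auto
        then show ?thesis using n[OF j] by (meson ereal_less_eq(3) of_nat_le_iff order_trans)
      qed
      then show "\<omega> \<in> (\<Union>n. ?A n)" using \<omega> by blast
    qed
  qed (use meas in auto)
  ultimately have lim: "(\<lambda>n. measure S (?A n)) \<longlonglongrightarrow> 1" by simp
  fix a :: real assume "a < 1"
  then have "eventually (\<lambda>n. a < measure S (?A n)) sequentially"
    using lim by (auto intro: order_tendstoD)
  then obtain n where n: "a < measure S (?A n)" by (meson eventually_sequentially order_refl)
  show "eventually (\<lambda>v. a < psi S N coord v) (to_infty N)"
    unfolding eventually_to_infty
  proof (intro exI[of _ "real n"] ballI impI)
    fix v assume v: "\<forall>i\<in>{1..N}. ereal (real n) < v i"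
    have "?A n \<subseteq> {\<omega>\<in>space S. \<forall>j\<in>{1..N}. T coord j 1 \<omega> \<le> v j}"
      using v by (blast intro: order_trans less_imp_le)
    then have "measure S (?A n) \<le> psi S N coord v"
      unfolding psi_def using measurable_T_coord_le by (rule P.finite_measure_mono)
    then show "a < psi S N coord v" using n by linarith
  qed
next
  fix a :: real assume "1 < a"
  then show "eventually (\<lambda>v. psi S N coord v < a) (to_infty N)"
    unfolding psi_def by (intro always_eventually allI order_le_less_trans[OF P.prob_le_1])
qed

lemma psi_solution:
  assumes V: "V \<in> P \<rightarrow>\<^sub>M real_vec N" and D: "D = distr P (real_vec N) V"
    and fin: "\<And>i. i \<in> {1..N} \<Longrightarrow> (\<integral>\<^sup>+x. ennreal (x i) \<partial>D) < \<infinity>"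
    and neg: "\<And>i. i \<in> {1..N} \<Longrightarrow> ext_expectation D (\<lambda>x. x i) < 0"
  shows "solution P N V (psi S N coord)"
  unfolding solution_def
proof (intro conjI ballI)
  show "psi S N coord \<in> borel_measurable (ereal_vec N)" by (rule measurable_psi)
  show "\<exists>B. \<forall>v\<in>rbar N. \<bar>psi S N coord v\<bar> \<le> B"
    by (intro exI[of _ 1]) (simp add: psi_def P.prob_le_1)
  have "psi S N coord (infty_vec N) = measure S (space S)"
    unfolding psi_def infty_vec_def by (intro arg_cong[of _ _ "measure S"]) auto
  then show "psi S N coord (infty_vec N) = 1" by (simp add: P.prob_space)
  show "(psi S N coord \<longlongrightarrow> 1) (to_infty N)" by (rule psi_tendsto_1[OF fin neg])
  fix v
  have id: "(\<lambda>x. x) \<in> D \<rightarrow>\<^sub>M real_vec N" by measurable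
  have meas: "integrand N (\<lambda>x. x) (psi S N coord) v \<in> borel_measurable (real_vec N)"
    using measurable_integrand[OF N id measurable_psi] by (simp add: measurable_cong_sets[OF sets_D refl])
  have "(\<integral>\<omega>. integrand N V (psi S N coord) v \<omega> \<partial>P) =
    (\<integral>\<omega>. integrand N (\<lambda>x. x) (psi S N coord) v (V \<omega>) \<partial>P)"
    by (simp add: integrand_cases)
  also have "\<dots> = (\<integral>x. integrand N (\<lambda>x. x) (psi S N coord) v x \<partial>D)"
    using integral_distr[OF V meas] by (simp only: D[symmetric])
  also have "\<dots> = enn2real (\<integral>\<^sup>+x. ennreal (integrand N (\<lambda>x. x) (psi S N coord) v x) \<partial>D)"
    by (rule integral_eq_nn_integral[OF measurable_integrand[OF N id measurable_psi]])
       (auto simp: integrand_cases psi_def)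
  also have "\<dots> = psi S N coord v" by (simp add: psi_eq_nn_integral[symmetric] psi_def)
  finally show "(\<integral>\<omega>. integrand N V (psi S N coord) v \<omega> \<partial>P) = psi S N coord v" .
qed

end

text \<open>
  The random vectors enter \<open>\<psi>\<close> through their joint law only, so that they may be taken as the
  coordinates of the product space, where shifting the sequence is available.
\<close>

lemma (in prob_space) psi_eq_psi_coord:
  assumes N: "1 \<le> N" and indep: "indep_vars (\<lambda>_. real_vec N) W {1..}"
    and law: "\<And>n. 1 \<le> n \<Longrightarrow> distr M (real_vec N) (W n) = D"
  shows "psi M N W v = psi (PiM UNIV (\<lambda>_. D)) N coord v"
proof -
  have rv[measurable]: "W n \<in> M \<rightarrow>\<^sub>M real_vec N" if "1 \<le> n" for n
    using indep that by (auto simp: indep_vars_def)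
  have D_eq: "D = distr M (real_vec N) (W 1)" by (simp only: law[OF order_refl])
  have D: "prob_space D" unfolding D_eq by (rule prob_space_distr[OF rv[OF order_refl]])
  have sets_D: "sets D = sets (real_vec N)" unfolding D_eq by simp
  have joint: "distr M (PiM {1..} (\<lambda>_. real_vec N)) (\<lambda>\<omega>. \<lambda>n\<in>{1..}. W n \<omega>) = PiM {1..} (\<lambda>_. D)"
  proof -
    have "distr M (PiM {1..} (\<lambda>_. real_vec N)) (\<lambda>\<omega>. \<lambda>n\<in>{1..}. W n \<omega>) =
      PiM {1..} (\<lambda>n. distr M (real_vec N) (W n))"
      using indep_vars_iff_distr_eq_PiM'[of "{1..}" W "\<lambda>_. real_vec N"] indep rv by auto
    also have "\<dots> = PiM {1..} (\<lambda>_. D)" using law by (intro PiM_cong) simp_all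
    finally show ?thesis .
  qed
  interpret iid_vectors D N
  proof (intro iid_vectors.intro iid_vectors_axioms.intro N sets_D)
    interpret D: prob_space D by (rule D)
    show "sequence_space D" ..
  qed
  let ?X = "\<lambda>\<omega> n. W (Suc n) \<omega>"
  have "distr M (PiM UNIV (\<lambda>_. real_vec N)) ?X =
    distr (PiM {1..} (\<lambda>_. D)) (PiM UNIV (\<lambda>_. D)) (\<lambda>\<omega>. \<lambda>n\<in>UNIV. \<omega> (Suc n))"
  proof -
    let ?shift = "\<lambda>\<omega>. \<lambda>n\<in>(UNIV :: nat set). \<omega> (Suc n) :: nat \<Rightarrow> real"
    have shift: "?shift \<in> PiM {1..} (\<lambda>_. real_vec N) \<rightarrow>\<^sub>M PiM UNIV (\<lambda>_. real_vec N)"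
      by (rule measurable_restrict) (rule measurable_component_singleton, simp)
    have W: "(\<lambda>\<omega>. \<lambda>n\<in>{1..}. W n \<omega>) \<in> M \<rightarrow>\<^sub>M PiM {1..} (\<lambda>_. real_vec N)"
      by (rule measurable_restrict) (rule rv, simp)
    have "?shift \<circ> (\<lambda>\<omega>. \<lambda>n\<in>{1..}. W n \<omega>) = ?X" by (simp add: fun_eq_iff)
    then have "distr M (PiM UNIV (\<lambda>_. real_vec N)) ?X =
      distr (PiM {1..} (\<lambda>_. D)) (PiM UNIV (\<lambda>_. real_vec N)) ?shift"
      using distr_distr[OF shift W] by (simp only: joint)
    also have "\<dots> = distr (PiM {1..} (\<lambda>_. D)) (PiM UNIV (\<lambda>_. D)) ?shift"
      by (rule distr_cong) (simp_all only: sets_PiM_cong[OF refl sets_D])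
    finally show ?thesis .
  qed
  also have "\<dots> = S"
    by (rule distr_PiM_reindex[of "{1..}" "\<lambda>_. D" Suc UNIV]) (auto simp: D)
  finally have X_law: "distr M (PiM UNIV (\<lambda>_. real_vec N)) ?X = S" .
  have X: "?X \<in> M \<rightarrow>\<^sub>M PiM UNIV (\<lambda>_. real_vec N)"
  proof -
    have "(\<lambda>\<omega>. \<lambda>n\<in>UNIV. W (Suc n) \<omega>) \<in> M \<rightarrow>\<^sub>M PiM UNIV (\<lambda>_. real_vec N)"
      by (rule measurable_restrict) (rule rv, simp)
    then show ?thesis by (simp only: restrict_UNIV)
  qed
  let ?A = "{\<omega>\<in>space S. \<forall>j\<in>{1..N}. T coord j 1 \<omega> \<le> v j}"
  have A: "?A \<in> sets (PiM UNIV (\<lambda>_. real_vec N))"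
    using measurable_T_coord_le[of v] by (simp add: sets_PiM_cong[OF refl sets_D])
  have "psi S N coord v = measure (distr M (PiM UNIV (\<lambda>_. real_vec N)) ?X) ?A"
    by (simp only: psi_def X_law)
  also have "\<dots> = measure M (?X -` ?A \<inter> space M)" by (rule measure_distr[OF X A])
  also have "?X -` ?A \<inter> space M = {\<omega> \<in> space M. \<forall>j\<in>{1..N}. T W j 1 \<omega> \<le> v j}"
  proof -
    have "?X \<omega> \<in> space S" if "\<omega> \<in> space M" for \<omega>
      using measurable_space[OF X that] by (simp add: space_PiM space_D)
    moreover have "T coord j 1 (?X \<omega>) = T W j 1 \<omega>" for \<omega> j
      by (rule T_cong) (simp add: coord_def)
    ultimately show ?thesis by auto
  qed
  finally show ?thesis by (simp add: psi_def)
qed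

section \<open>Existence, uniqueness and bounds\<close>

theorem theorem4:
  fixes P :: "'a measure" and M :: nat
    and V :: "'a \<Rightarrow> nat \<Rightarrow> real" and W :: "nat \<Rightarrow> 'a \<Rightarrow> nat \<Rightarrow> real"
  assumes "prob_space P" and "M \<ge> 1"
    and "V \<in> P \<rightarrow>\<^sub>M real_vec M"
    and "\<And>i. i \<in> {1..M} \<Longrightarrow> measure P {\<omega> \<in> space P. V \<omega> i > 0} > 0"
    and "\<And>i. i \<in> {1..M} \<Longrightarrow> (\<integral>\<^sup>+\<omega>. ennreal (V \<omega> i) \<partial>P) < \<infinity>"
    and "\<And>i. i \<in> {1..M} \<Longrightarrow> ext_expectation P (\<lambda>\<omega>. V \<omega> i) < 0"
    and "prob_space.indep_vars P (\<lambda>_. real_vec M) W {1..}"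
    and "\<And>n. n \<ge> 1 \<Longrightarrow> distr P (real_vec M) (W n) = distr P (real_vec M) V"
  shows
    "(solution P M V (psi P M W) \<and>
      (\<forall>f. solution P M V f \<longrightarrow> (\<forall>v\<in>rbar M. f v = psi P M W v))) \<and>
     (\<forall>(\<gamma> :: (nat \<Rightarrow> ereal) \<Rightarrow> real) K.
        \<gamma> \<in> borel_measurable (ereal_vec M) \<longrightarrow>
        (\<forall>v\<in>rbar M. \<gamma> v \<le> K) \<longrightarrow>
        (\<forall>v\<in>supp M (\<lambda>v. max (\<gamma> v) 0). ext_expectation P (integrand M V \<gamma> v) \<ge> ereal (\<gamma> v)) \<longrightarrow>
        \<gamma> (infty_vec M) = 1 \<longrightarrow>
        Limsup (to_infty M) (\<lambda>v. ereal (\<gamma> v)) = 1 \<longrightarrow>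
        (\<forall>v\<in>rbar M. psi P M W v \<ge> \<gamma> v)) \<and>
     (\<forall>\<eta> :: (nat \<Rightarrow> ereal) \<Rightarrow> real.
        \<eta> \<in> borel_measurable (ereal_vec M) \<longrightarrow>
        (\<forall>v\<in>rbar M. \<eta> v \<ge> 0) \<longrightarrow>
        (\<forall>v\<in>supp M (psi P M W). ext_expectation P (integrand M V \<eta> v) \<le> ereal (\<eta> v)) \<longrightarrow>
        \<eta> (infty_vec M) = 1 \<longrightarrow>
        Liminf (to_infty M) (\<lambda>v. ereal (\<eta> v)) = 1 \<longrightarrow>
        (\<forall>v\<in>rbar M. psi P M W v \<le> \<eta> v))"
proof -
  interpret prob_space P by (rule assms(1))
  note V = assms(3)
  define D where "D = distr P (real_vec M) V"
  have sets_D: "sets D = sets (real_vec M)" by (simp add: D_def)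
  interpret D: prob_space D unfolding D_def by (rule prob_space_distr[OF V])
  interpret Q: iid_vectors D M
  proof (intro iid_vectors.intro iid_vectors_axioms.intro assms(2) sets_D)
    show "sequence_space D" ..
  qed
  have fin: "(\<integral>\<^sup>+x. ennreal (x i) \<partial>D) < \<infinity>" and neg: "ext_expectation D (\<lambda>x. x i) < 0"
    if i: "i \<in> {1..M}" for i
  proof -
    have "(\<lambda>x. x i) \<in> borel_measurable (real_vec M)" by (rule measurable_component_singleton[OF i])
    then have law: "(\<integral>\<^sup>+x. ennreal (x i) \<partial>D) = (\<integral>\<^sup>+\<omega>. ennreal (V \<omega> i) \<partial>P)"
      "(\<integral>\<^sup>+x. ennreal (- x i) \<partial>D) = (\<integral>\<^sup>+\<omega>. ennreal (- V \<omega> i) \<partial>P)"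
      unfolding D_def by (subst nn_integral_distr[OF V]; simp)+
    show "(\<integral>\<^sup>+x. ennreal (x i) \<partial>D) < \<infinity>" using assms(5)[OF i] by (simp only: law)
    show "ext_expectation D (\<lambda>x. x i) < 0"
      using assms(6)[OF i] by (simp only: law ext_expectation_def)
  qed
  have psi_eq: "psi P M W = psi (PiM UNIV (\<lambda>_. D)) M coord"
    by (rule ext, rule psi_eq_psi_coord[OF assms(2) assms(7)]) (simp only: D_def assms(8))
  let ?\<psi> = "psi P M W"
  have sol: "solution P M V ?\<psi>"
    unfolding psi_eq by (rule Q.psi_solution[OF V D_def fin neg])
  have \<psi>: "?\<psi> \<in> borel_measurable (ereal_vec M)" "?\<psi> (infty_vec M) = 1" "(?\<psi> \<longlongrightarrow> 1) (to_infty M)"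
    and \<psi>_eq: "\<And>v. v \<in> rbar M \<Longrightarrow> (\<integral>\<omega>. integrand M V ?\<psi> v \<omega> \<partial>P) = ?\<psi> v"
    using sol by (auto simp: solution_def)
  have \<psi>_bounds: "0 \<le> ?\<psi> v" "?\<psi> v \<le> 1" for v
    by (simp_all add: psi_def)
  have int_\<psi>: "integrable P (integrand M V ?\<psi> v)" for v
    by (rule integrable_integrand_bounded[OF assms(2) V \<psi>(1), where B=1]) (simp add: \<psi>_bounds)
  have compare: "\<gamma> v \<le> ?\<psi> v"
    if "\<gamma> \<in> borel_measurable (ereal_vec M)" "\<And>v. v \<in> rbar M \<Longrightarrow> \<gamma> v \<le> K"
      "\<And>v. v \<in> rbar M \<Longrightarrow> 0 < \<gamma> v \<Longrightarrow> ereal (\<gamma> v) \<le> ext_expectation P (integrand M V \<gamma> v)"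
      "\<gamma> (infty_vec M) = 1" "\<And>e. 0 < e \<Longrightarrow> eventually (\<lambda>v. \<gamma> v < 1 + e) (to_infty M)"
      "v \<in> rbar M" for \<gamma> K v
    by (rule subsolution_le_nonneg_solution[OF assms(2) V assms(4) sol \<psi>_bounds(1) that])
  have below: "\<gamma> v \<le> ?\<psi> v"
    if "\<gamma> \<in> borel_measurable (ereal_vec M)" "\<forall>v\<in>rbar M. \<gamma> v \<le> K"
      "\<forall>v\<in>supp M (\<lambda>v. max (\<gamma> v) 0). ext_expectation P (integrand M V \<gamma> v) \<ge> ereal (\<gamma> v)"
      "\<gamma> (infty_vec M) = 1" "Limsup (to_infty M) (\<lambda>v. ereal (\<gamma> v)) = 1" "v \<in> rbar M"
    for \<gamma> K v
  proof (rule compare[OF that(1) _ _ that(4) _ that(6)])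
    fix e :: real assume "0 < e"
    then have "1 < ereal (1 + e)" by (simp add: one_ereal_def)
    moreover have "Limsup (to_infty M) (\<lambda>v. ereal (\<gamma> v)) \<le> 1" using that(5) by simp
    ultimately have "eventually (\<lambda>v. ereal (\<gamma> v) < ereal (1 + e)) (to_infty M)"
      unfolding Limsup_le_iff by blast
    then show "eventually (\<lambda>v. \<gamma> v < 1 + e) (to_infty M)" by simp
  qed (use that(2,3) in \<open>auto simp: supp_def max_def\<close>)
  \<comment> \<open>The comparison principle for \<open>2 \<psi> - \<eta>\<close>, in a form that covers both uniqueness and part (c).\<close>
  have above: "?\<psi> v \<le> \<eta> v"
    if \<eta>: "\<eta> \<in> borel_measurable (ereal_vec M)"
      and lower: "\<And>v. v \<in> rbar M \<Longrightarrow> B \<le> \<eta> v"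
      and super: "\<And>v. v \<in> rbar M \<Longrightarrow> \<eta> v < 2 * ?\<psi> v \<Longrightarrow>
        integrable P (integrand M V \<eta> v) \<and> (\<integral>\<omega>. integrand M V \<eta> v \<omega> \<partial>P) \<le> \<eta> v"
      and infty: "\<eta> (infty_vec M) = 1"
      and limit: "\<And>e. 0 < e \<Longrightarrow> eventually (\<lambda>v. 1 - e < \<eta> v) (to_infty M)"
      and v: "v \<in> rbar M"
    for \<eta> v B
  proof -
    let ?\<gamma> = "\<lambda>v. 2 * ?\<psi> v - \<eta> v"
    have "?\<gamma> v \<le> ?\<psi> v"
    proof (rule compare[OF _ _ _ _ _ v])
      show "?\<gamma> \<in> borel_measurable (ereal_vec M)" using \<psi>(1) \<eta> by measurable
      show "?\<gamma> w \<le> 2 - B" if "w \<in> rbar M" for w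
        using lower[OF that] \<psi>_bounds(2)[of w] by linarith
      show "?\<gamma> (infty_vec M) = 1" using \<psi>(2) infty by simp
      fix w assume w: "w \<in> rbar M" "0 < ?\<gamma> w"
      then have int: "integrable P (integrand M V \<eta> w)"
        and le: "(\<integral>\<omega>. integrand M V \<eta> w \<omega> \<partial>P) \<le> \<eta> w" using super[of w] by auto
      have split: "integrand M V ?\<gamma> w = (\<lambda>\<omega>. 2 * integrand M V ?\<psi> w \<omega> - integrand M V \<eta> w \<omega>)"
        by (simp add: fun_eq_iff integrand_cases)
      have "(\<integral>\<omega>. integrand M V ?\<gamma> w \<omega> \<partial>P) = 2 * ?\<psi> w - (\<integral>\<omega>. integrand M V \<eta> w \<omega> \<partial>P)"
        unfolding split using int int_\<psi>[of w] \<psi>_eq[OF w(1)] by simp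
      moreover have "integrable P (integrand M V ?\<gamma> w)"
        unfolding split using int int_\<psi>[of w] by simp
      ultimately show "ereal (?\<gamma> w) \<le> ext_expectation P (integrand M V ?\<gamma> w)"
        using le by (simp add: ext_expectation_integrable)
    next
      fix e :: real assume e: "0 < e"
      have "eventually (\<lambda>v. ?\<psi> v < 1 + e / 4) (to_infty M)"
        using \<psi>(3) e by (intro order_tendstoD) auto
      moreover have "eventually (\<lambda>v. 1 - e / 4 < \<eta> v) (to_infty M)" using e by (intro limit) simp
      ultimately show "eventually (\<lambda>v. ?\<gamma> v < 1 + e) (to_infty M)"
        by eventually_elim (use e in auto)
    qed
    then show ?thesis by simp
  qed
  have unique: "f v = ?\<psi> v" if f: "solution P M V f" and v: "v \<in> rbar M" for f v
  proof -
    obtain B where B: "\<And>v. v \<in> rbar M \<Longrightarrow> \<bar>f v\<bar> \<le> B" using f by (auto simp: solution_def)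
    have f': "f \<in> borel_measurable (ereal_vec M)" "f (infty_vec M) = 1" "(f \<longlongrightarrow> 1) (to_infty M)"
      and eq: "\<And>v. v \<in> rbar M \<Longrightarrow> (\<integral>\<omega>. integrand M V f v \<omega> \<partial>P) = f v"
      using f by (auto simp: solution_def)
    have int: "integrable P (integrand M V f v)" for v
      by (rule integrable_integrand_bounded[OF assms(2) V f'(1) B])
    have "f v \<le> ?\<psi> v"
    proof (rule compare[OF f'(1) _ _ f'(2) _ v])
      show "f w \<le> B" if "w \<in> rbar M" for w using B[OF that] by linarith
      show "ereal (f w) \<le> ext_expectation P (integrand M V f w)" if "w \<in> rbar M" for w
        by (simp add: ext_expectation_integrable[OF int] eq[OF that])
      show "eventually (\<lambda>v. f v < 1 + e) (to_infty M)" if "0 < e" for e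
        using f'(3) that by (intro order_tendstoD) auto
    qed
    moreover have "?\<psi> v \<le> f v"
    proof (rule above[OF f'(1) _ _ f'(2) _ v])
      show "- B \<le> f w" if "w \<in> rbar M" for w using B[OF that] by linarith
      show "integrable P (integrand M V f w) \<and> (\<integral>\<omega>. integrand M V f w \<omega> \<partial>P) \<le> f w"
        if "w \<in> rbar M" for w using int eq[OF that] by simp
      show "eventually (\<lambda>v. 1 - e < f v) (to_infty M)" if "0 < e" for e
        using f'(3) that by (intro order_tendstoD) auto
    qed
    ultimately show ?thesis by simp
  qed
  have above_ext: "?\<psi> v \<le> \<eta> v"
    if \<eta>: "\<eta> \<in> borel_measurable (ereal_vec M)" "\<forall>v\<in>rbar M. \<eta> v \<ge> 0"
      "\<forall>v\<in>supp M ?\<psi>. ext_expectation P (integrand M V \<eta> v) \<le> ereal (\<eta> v)"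
      "\<eta> (infty_vec M) = 1" "Liminf (to_infty M) (\<lambda>v. ereal (\<eta> v)) = 1" "v \<in> rbar M"
    for \<eta> v
  proof (rule above[OF \<eta>(1) _ _ \<eta>(4) _ \<eta>(6)])
    show "0 \<le> \<eta> w" if "w \<in> rbar M" for w using \<eta>(2) that by blast
    fix w assume w: "w \<in> rbar M" "\<eta> w < 2 * ?\<psi> w"
    then have "w \<in> supp M ?\<psi>" using \<eta>(2) by (force simp: supp_def)
    then have le: "ext_expectation P (integrand M V \<eta> w) \<le> ereal (\<eta> w)" using \<eta>(3) by blast
    have int: "integrable P (integrand M V \<eta> w)"
      by (rule ext_expectation_le_imp_integrable[OF measurable_integrand[OF assms(2) V \<eta>(1)] _ le])
         (use \<eta>(2) step_in_rbar in \<open>auto simp: integrand_cases\<close>)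
    then show "integrable P (integrand M V \<eta> w) \<and> (\<integral>\<omega>. integrand M V \<eta> w \<omega> \<partial>P) \<le> \<eta> w"
      using le by (simp add: ext_expectation_integrable)
  next
    fix e :: real assume "0 < e"
    then have "ereal (1 - e) < 1" by (simp add: one_ereal_def)
    moreover have "1 \<le> Liminf (to_infty M) (\<lambda>v. ereal (\<eta> v))" using \<eta>(5) by simp
    ultimately have "eventually (\<lambda>v. ereal (1 - e) < ereal (\<eta> v)) (to_infty M)"
      unfolding le_Liminf_iff by blast
    then show "eventually (\<lambda>v. 1 - e < \<eta> v) (to_infty M)" by simp
  qed
  show ?thesis using sol unique below above_ext by blast
qed

end
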